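(* Let $n,m,p\ge1$, and let $F:\mathbf{SVect}^n\to\mathbf{SVect}^m$ and $G:\mathbf{SVect}^m\to\mathbf{SVect}^p$ be arbitrary $\mathbb C$-linear functors, with rank matrices $\mathbf R^F$ and $\mathbf R^G$ and gauges $(s^F_1,\dots,s^F_m)$ and $(s^G_1,\dots,s^G_p)$, respectively. Then the rank matrix and the gauge of the composite functor $G\circ F$ are given by $$\mathbf R^{G\circ F}=\mathbf R^G\mathbf R^F$$ (usual matrix product) and $$s_k^{G\circ F}(\mathbf a)=s_k^G(\mathbf R^F(\mathbf a))\left(\bigoplus_{i=1}^m \mathrm{Id}_{\mathbf R^G_{ki}}\otimes s_i^F(\mathbf a)\right)\mathbf P(\mathbf R^G_k,\mathbf R^F,\mathbf a)\left(\bigoplus_{j=1}^n s^G_k(\mathbf R^F(\mathbf e_j))^{-1}\otimes \mathrm{Id}_{a_j}\right)$$ for all $k=1,\dots,p$ and all $\mathbf a=(a_1,\dots,a_n)\in\mathbb N^n$.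
   Context: $\mathbb N=\{0,1,2,\dots\}$. $\mathbf{SVect}$ is the full subcategory of the category of finite dimensional complex vector spaces with objects $\mathbb C^a$, $a\ge0$; $\mathbf{SVect}^n$ is its $n$-fold product. A functor is $\mathbb C$-linear if it is $\mathbb C$-linear on hom spaces. A functor $F:\mathbf{SVect}^n\to\mathbf{SVect}^m$ has components $F_1,\dots,F_m:\mathbf{SVect}^n\to\mathbf{SVect}$. $\mathbb C(j,n)=(0,\dots,0,\mathbb C,0,\dots,0)$ ($\mathbb C$ in position $j$). The rank matrix $\mathbf R=\mathbf R^F$ has entries $\mathbf R_{ij}=\dim F_i(\mathbb C(j,n))$. $\mathbf R_i$ is the $i$-th row, $\mathbf R(\mathbf a)$ the usual product of the matrix with the column vector $\mathbf a$, $\mathbf a\cdot\mathbf r=\sum_ja_jr_j$, $\mathbf e_j$ the canonical basis vectors, $[f]$ the matrix of a linear map in canonical bases. $\bigoplus$ of matrices is the block diagonal matrix and $\mathrm{Id}_r\otimes M$ is the block diagonal matrix with $r$ copies of $M$ ($M\otimes N$ is the Kronecker product with blocks $M_{uv}N$). Matrices with zero rows or columns are allowed (so a $p\times0$ block in a direct sum contributes $p$ zero rows, and a $0\times q$ block contributes $q$ zero columns). Reference functors: for $\mathbf r\in\mathbb N^n$, $H(\mathbf r):\mathbf{SVect}^n\to\mathbf{SVect}$ sends $(\mathbb C^{a_1},\dots,\mathbb C^{a_n})$ to $\mathbb C^{\mathbf a\cdot\mathbf r}$ and $[H(\mathbf r)(f_1,\dots,f_n)]=\bigoplus_{j=1}^n\mathrm{Id}_{r_j}\otimes[f_j]$.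 Gauge: for $\mathbf r\in\mathbb N^n$ let $\mathcal S(\mathbf r)$ be the set of families $s=(s(\mathbf a))_{\mathbf a\in\mathbb N^n}$ of invertible complex matrices $s(\mathbf a)$ of size $\mathbf a\cdot\mathbf r$ (trivial if $\mathbf a\cdot\mathbf r=0$) with $s(\mathbf e_k)=\mathrm{Id}_{r_k}$ for all $k$. The gauge of a $\mathbb C$-linear functor $F:\mathbf{SVect}^n\to\mathbf{SVect}^m$ with rank matrix $\mathbf R$ is the unique $(s_1,\dots,s_m)\in\mathcal S(\mathbf R_1)\times\cdots\times\mathcal S(\mathbf R_m)$ such that for every $i$ and every morphism $(f_1,\dots,f_n):(\mathbb C^{a_1},\dots,\mathbb C^{a_n})\to(\mathbb C^{a_1'},\dots,\mathbb C^{a_n'})$, $$[F_i(f_1,\dots,f_n)]=s_i(\mathbf a')\,[H(\mathbf R_i)(f_1,\dots,f_n)]\,s_i(\mathbf a)^{-1}.$$ Permutation matrices: for $\mathbf r'\in\mathbb N^m$, $\mathbf R$ an $m\times n$ matrix over $\mathbb N$ and $\mathbf a\in\mathbb N^n$, put $\tilde r_j=\sum_ir'_i\mathbf R_{ij}$. $\mathbf P(\mathbf r',\mathbf R,\mathbf a)$ is the permutation matrix of order $\sum_j\tilde r_ja_j$ such that, for all endomorphisms $(f_1,\dots,f_n)$ of $(\mathbb C^{a_1},\dots,\mathbb C^{a_n})$, conjugation $M\mapsto\mathbf PM\mathbf P^{-1}$ takes $\bigoplus_{j=1}^n\mathrm{Id}_{\tilde r_j}\otimes[f_j]$ to $\bigoplus_{i=1}^m\mathrm{Id}_{r'_i}\otimes\big(\bigoplus_{j=1}^n\mathrm{Id}_{\mathbf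 R_{ij}}\otimes[f_j]\big)$ by moving whole diagonal blocks without changing the relative order of the various copies of $[f_j]$, for each $j$. Explicitly: index the source basis by $(j,t,x)$, $1\le j\le n$, $1\le t\le\tilde r_j$, $1\le x\le a_j$, and the target basis by $(i,u,j,v,x)$, $1\le i\le m$, $1\le u\le r'_i$, $1\le j\le n$, $1\le v\le\mathbf R_{ij}$, $1\le x\le a_j$, both ordered lexicographically; $\mathbf P$ sends the basis vector $(j,t,x)$ to $(i,u,j,v,x)$, where, for that $j$, $(i,u,v)$ is the $t$-th triple in lexicographic order among those with $1\le u\le r'_i$, $1\le v\le\mathbf R_{ij}$. *)

theory Defs
  imports Complex_Main "Jordan_Normal_Form.Gauss_Jordan_Elimination"
begin

text \<open>
  The category \<open>SVect\<^sup>n\<close>.  The object \<open>(C\<^bsup>a\<^sub>1\<^esup>, \<dots>, C\<^bsup>a\<^sub>n\<^esup>)\<close> is the vector of its dimensions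
  \<open>a \<in> carrier_vec n\<close>.  A linear map between the spaces \<open>C\<^sup>a\<close> is identified with its matrix in the
  canonical bases, so a morphism is a list of \<open>n\<close> matrices (whose dimensions determine source and
  target) and composition is the componentwise matrix product.  All indices start at 0.
\<close>

definition svect_hom :: "nat \<Rightarrow> nat vec \<Rightarrow> nat vec \<Rightarrow> complex mat list set" where
  "svect_hom n a a' = {fs. length fs = n \<and> (\<forall>j<n. fs ! j \<in> carrier_mat (a' $ j) (a $ j))}"

definition svect_id :: "nat \<Rightarrow> nat vec \<Rightarrow> complex mat list" where
  "svect_id n a = map (\<lambda>j. 1\<^sub>m (a $ j)) [0..<n]"

definition svect_comp :: "complex mat list \<Rightarrow> complex mat list \<Rightarrow> complex mat list" where
  "svect_comp gs fs = map2 (*) gs fs"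

definition svect_add :: "complex mat list \<Rightarrow> complex mat list \<Rightarrow> complex mat list" where
  "svect_add fs gs = map2 (+) fs gs"

definition svect_smult :: "complex \<Rightarrow> complex mat list \<Rightarrow> complex mat list" where
  "svect_smult c fs = map (\<lambda>f. c \<cdot>\<^sub>m f) fs"

text \<open>
  For \<open>F\<close> into \<open>SVect\<^sup>m\<close>, the component \<open>F\<^sub>i\<close> is \<open>a \<mapsto> on_obj F a $ i\<close> on objects and
  \<open>fs \<mapsto> on_mor F fs ! i\<close> on morphisms.
\<close>

record svect_functor =
  on_obj :: "nat vec \<Rightarrow> nat vec"
  on_mor :: "complex mat list \<Rightarrow> complex mat list"

definition is_functor :: "nat \<Rightarrow> nat \<Rightarrow> svect_functor \<Rightarrow> bool" where
  "is_functor n m F \<longleftrightarrow>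
     (\<forall>a\<in>carrier_vec n. on_obj F a \<in> carrier_vec m) \<and>
     (\<forall>a\<in>carrier_vec n. \<forall>a'\<in>carrier_vec n. \<forall>fs\<in>svect_hom n a a'.
        on_mor F fs \<in> svect_hom m (on_obj F a) (on_obj F a')) \<and>
     (\<forall>a\<in>carrier_vec n. on_mor F (svect_id n a) = svect_id m (on_obj F a)) \<and>
     (\<forall>a\<in>carrier_vec n. \<forall>a'\<in>carrier_vec n. \<forall>a''\<in>carrier_vec n.
        \<forall>fs\<in>svect_hom n a a'. \<forall>gs\<in>svect_hom n a' a''.
          on_mor F (svect_comp gs fs) = svect_comp (on_mor F gs) (on_mor F fs))"

definition is_linear_functor :: "nat \<Rightarrow> nat \<Rightarrow> svect_functor \<Rightarrow> bool" where
  "is_linear_functor n m F \<longleftrightarrow>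
     is_functor n m F \<and>
     (\<forall>a\<in>carrier_vec n. \<forall>a'\<in>carrier_vec n.
        (\<forall>fs\<in>svect_hom n a a'. \<forall>gs\<in>svect_hom n a a'.
           on_mor F (svect_add fs gs) = svect_add (on_mor F fs) (on_mor F gs)) \<and>
        (\<forall>c. \<forall>fs\<in>svect_hom n a a'. on_mor F (svect_smult c fs) = svect_smult c (on_mor F fs)))"

definition functor_comp :: "svect_functor \<Rightarrow> svect_functor \<Rightarrow> svect_functor" (infixl "\<circ>\<^sub>F" 55) where
  "G \<circ>\<^sub>F F = \<lparr>on_obj = on_obj G \<circ> on_obj F, on_mor = on_mor G \<circ> on_mor F\<rparr>"

text \<open>\<open>C(j,n)\<close> is the object with dimension vector \<open>unit_vec n j\<close>.\<close>

definition rank_matrix :: "nat \<Rightarrow> nat \<Rightarrow> svect_functor \<Rightarrow> nat mat" where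
  "rank_matrix n m F = mat m n (\<lambda>(i, j). on_obj F (unit_vec n j) $ i)"

definition kronecker :: "'a :: times mat \<Rightarrow> 'a mat \<Rightarrow> 'a mat" (infixl "\<otimes>\<^sub>K" 70) where
  "A \<otimes>\<^sub>K B = mat (dim_row A * dim_row B) (dim_col A * dim_col B)
     (\<lambda>(i, j). A $$ (i div dim_row B, j div dim_col B) * B $$ (i mod dim_row B, j mod dim_col B))"

text \<open>The reference functor \<open>H(r)\<close>; its target \<open>SVect\<close> is \<open>SVect\<^sup>1\<close>.\<close>

definition ref_functor :: "nat vec \<Rightarrow> svect_functor" where
  "ref_functor r =
     \<lparr>on_obj = (\<lambda>a. vec 1 (\<lambda>_. a \<bullet> r)),
      on_mor = (\<lambda>fs. [diag_block_mat (map (\<lambda>j. 1\<^sub>m (r $ j) \<otimes>\<^sub>K fs ! j) [0..<dim_vec r])])\<rparr>"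

text \<open>On an invertible matrix \<open>mat_inverse\<close> returns \<open>Some\<close> of the two-sided inverse.\<close>

abbreviation mat_inv :: "complex mat \<Rightarrow> complex mat" where
  "mat_inv A \<equiv> the (mat_inverse A)"

text \<open>
  The set \<open>S(r)\<close>.  A family indexed by \<open>carrier_vec n\<close> is an extensional function, so that
  families are equal as soon as they agree on \<open>carrier_vec n\<close>.
\<close>

definition gauge_families :: "nat vec \<Rightarrow> (nat vec \<Rightarrow> complex mat) set" where
  "gauge_families r =
     {s \<in> (\<Pi>\<^sub>E a\<in>carrier_vec (dim_vec r). {A \<in> carrier_mat (a \<bullet> r) (a \<bullet> r). invertible_mat A}).
        \<forall>k<dim_vec r. s (unit_vec (dim_vec r) k) = 1\<^sub>m (r $ k)}"

definition is_gauge :: "nat \<Rightarrow> nat \<Rightarrow> svect_functor \<Rightarrow> (nat \<Rightarrow> nat vec \<Rightarrow> complex mat) \<Rightarrow> bool" where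
  "is_gauge n m F s \<longleftrightarrow>
     s \<in> (\<Pi>\<^sub>E i\<in>{..<m}. gauge_families (row (rank_matrix n m F) i)) \<and>
     (\<forall>i<m. \<forall>a\<in>carrier_vec n. \<forall>a'\<in>carrier_vec n. \<forall>fs\<in>svect_hom n a a'.
        on_mor F fs ! i =
          s i a' * (on_mor (ref_functor (row (rank_matrix n m F) i)) fs ! 0) * mat_inv (s i a))"

definition gauge :: "nat \<Rightarrow> nat \<Rightarrow> svect_functor \<Rightarrow> nat \<Rightarrow> nat vec \<Rightarrow> complex mat" where
  "gauge n m F = (THE s. is_gauge n m F s)"

text \<open>
  The permutation matrix \<open>P(r',R,a)\<close>.  List comprehensions enumerate tuples in lexicographic order,
  so \<open>perm_source ! q\<close> and \<open>perm_target ! p\<close> are the labels of the \<open>q\<close>-th source and \<open>p\<close>-th target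
  basis vectors, and \<open>perm_triples r' R j ! t\<close> is the \<open>t\<close>-th admissible triple \<open>(i,u,v)\<close> for \<open>j\<close>.
\<close>

definition perm_triples :: "nat vec \<Rightarrow> nat mat \<Rightarrow> nat \<Rightarrow> (nat \<times> nat \<times> nat) list" where
  "perm_triples r' R j =
     [(i, u, v). i \<leftarrow> [0..<dim_row R], u \<leftarrow> [0..<r' $ i], v \<leftarrow> [0..<R $$ (i, j)]]"

definition perm_mult :: "nat vec \<Rightarrow> nat mat \<Rightarrow> nat \<Rightarrow> nat" where
  "perm_mult r' R j = (\<Sum>i<dim_row R. r' $ i * R $$ (i, j))"

definition perm_source :: "nat vec \<Rightarrow> nat mat \<Rightarrow> nat vec \<Rightarrow> (nat \<times> nat \<times> nat) list" where
  "perm_source r' R a =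
     [(j, t, x). j \<leftarrow> [0..<dim_col R], t \<leftarrow> [0..<perm_mult r' R j], x \<leftarrow> [0..<a $ j]]"

definition perm_target :: "nat vec \<Rightarrow> nat mat \<Rightarrow> nat vec \<Rightarrow> (nat \<times> nat \<times> nat \<times> nat \<times> nat) list" where
  "perm_target r' R a =
     [(i, u, j, v, x). i \<leftarrow> [0..<dim_row R], u \<leftarrow> [0..<r' $ i], j \<leftarrow> [0..<dim_col R],
        v \<leftarrow> [0..<R $$ (i, j)], x \<leftarrow> [0..<a $ j]]"

definition perm_matrix :: "nat vec \<Rightarrow> nat mat \<Rightarrow> nat vec \<Rightarrow> 'a :: {zero, one} mat" where
  "perm_matrix r' R a =
     (let N = (\<Sum>j<dim_col R. perm_mult r' R j * a $ j) in
      mat N N (\<lambda>(p, q).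
        case perm_source r' R a ! q of (j, t, x) \<Rightarrow>
        case perm_triples r' R j ! t of (i, u, v) \<Rightarrow>
          if perm_target r' R a ! p = (i, u, j, v, x) then 1 else 0))"

end

theory Submission
  imports Defs
begin

text \<open>
  A linear functor is determined on every object by its values on the inclusions
  \<open>\<iota>\<^sub>j\<^sub>x : C(j,n) \<rightarrow> a\<close> of the basis lines and on the corresponding projections.  Since a gauge is the
  identity on \<open>C(j,n)\<close>, it satisfies \<open>F\<^sub>i(\<iota>\<^sub>j\<^sub>x) = s\<^sub>i(a) H(R\<^sub>i)(\<iota>\<^sub>j\<^sub>x)\<close>; the images of the \<open>H(R\<^sub>i)(\<iota>\<^sub>j\<^sub>x)\<close>
  span, so \<open>s\<^sub>i(a)\<close> is the matrix whose columns are those of the \<open>F\<^sub>i(\<iota>\<^sub>j\<^sub>x)\<close>, with inverse made of the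
  rows of the images of the projections.  To compare two candidates for the gauge of \<open>G \<circ> F\<close> it
  therefore suffices to multiply both with the matrices \<open>H(R\<^sub>k)(\<iota>\<^sub>j\<^sub>x)\<close>: moving such a matrix leftwards
  through the last factor of the formula produces \<open>s\<^sub>k(R(e\<^sub>j))\<^sup>-\<^sup>1\<close> on its right, and \<open>P\<close> turns it into
  \<open>\<Oplus>\<^sub>i Id \<otimes> H(R\<^sub>i)(\<iota>\<^sub>j\<^sub>x)\<close>.

  All block matrices are handled as matrices whose rows and columns are labelled by lists of tuples,
  so that block diagonals and Kronecker products become conditions on labels.
\<close>

section \<open>Matrices with labelled rows and columns\<close>

definition label_mat :: "'a list \<Rightarrow> 'b list \<Rightarrow> ('a \<Rightarrow> 'b \<Rightarrow> 'c) \<Rightarrow> 'c mat" where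
  "label_mat L M f = mat (length L) (length M) (\<lambda>(i, j). f (L ! i) (M ! j))"

text \<open>The ordered counterpart of \<open>Sigma\<close>. The first component varies slowest, so
  nesting it over \<open>upt\<close> lists enumerates tuples lexicographically, in the order of rows
  and columns of a block matrix.\<close>

definition list_Sigma :: "'a list \<Rightarrow> ('a \<Rightarrow> 'b list) \<Rightarrow> ('a \<times> 'b) list" where
  "list_Sigma L M = concat (map (\<lambda>a. map (Pair a) (M a)) L)"

lemma set_list_Sigma [simp]: "set (list_Sigma L M) = Sigma (set L) (\<lambda>a. set (M a))"
  by (auto simp: list_Sigma_def)

lemma list_Sigma_Nil [simp]: "list_Sigma [] M = []"
  by (simp add: list_Sigma_def)

lemma list_Sigma_Cons [simp]: "list_Sigma (a # L) M = map (Pair a) (M a) @ list_Sigma L M"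
  by (simp add: list_Sigma_def)

lemma length_list_Sigma: "length (list_Sigma L M) = (\<Sum>a\<leftarrow>L. length (M a))"
  by (induction L) auto

lemma distinct_list_Sigma:
  "distinct L \<Longrightarrow> (\<And>a. a \<in> set L \<Longrightarrow> distinct (M a)) \<Longrightarrow> distinct (list_Sigma L M)"
  by (induction L) (auto simp: distinct_map inj_on_def)

lemma list_Sigma_const: "list_Sigma L (\<lambda>_. M) = List.product L M"
  by (simp add: list_Sigma_def product_concat_map)

lemma list_Sigma_cong:
  "(\<And>a. a \<in> set L \<Longrightarrow> M a = M' a) \<Longrightarrow> list_Sigma L M = list_Sigma L M'"
  by (induction L) auto

lemma list_Sigma_single:
  assumes "distinct L" and "a \<in> set L"
  shows "list_Sigma L (\<lambda>b. if b = a then M else []) = map (Pair a) M"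
proof -
  have "a \<notin> set L \<Longrightarrow> list_Sigma L (\<lambda>b. if b = a then M else []) = []" for L
    by (induction L) auto
  with assms show ?thesis
    by (induction L) auto
qed

lemma dim_label_mat [simp]:
  "dim_row (label_mat L M f) = length L" "dim_col (label_mat L M f) = length M"
  by (simp_all add: label_mat_def)

lemma index_label_mat [simp]:
  "i < length L \<Longrightarrow> j < length M \<Longrightarrow> label_mat L M f $$ (i, j) = f (L ! i) (M ! j)"
  by (simp add: label_mat_def)

lemma label_mat_carrier [simp]: "label_mat L M f \<in> carrier_mat (length L) (length M)"
  by (simp add: label_mat_def)

lemma label_mat_eq_iff:
  "label_mat L M f = label_mat L M g \<longleftrightarrow> (\<forall>a\<in>set L. \<forall>b\<in>set M. f a b = g a b)"
proof
  assume eq: "label_mat L M f = label_mat L M g"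
  have "f (L ! i) (M ! j) = g (L ! i) (M ! j)" if "i < length L" "j < length M" for i j
    using arg_cong[OF eq, of "\<lambda>A. A $$ (i, j)"] that by simp
  then show "\<forall>a\<in>set L. \<forall>b\<in>set M. f a b = g a b"
    by (metis in_set_conv_nth)
qed (auto intro!: eq_matI)

lemma label_mat_cong:
  assumes "\<And>a b. a \<in> set L \<Longrightarrow> b \<in> set M \<Longrightarrow> f a b = g a b"
  shows "label_mat L M f = label_mat L M g"
  using assms by (simp add: label_mat_eq_iff)

lemma label_mat_map:
  "label_mat (map h L) (map k M) f = label_mat L M (\<lambda>a b. f (h a) (k b))"
  by (auto intro!: eq_matI)

lemma label_mat_map_col: "label_mat L (map k M) f = label_mat L M (\<lambda>a b. f a (k b))"
  by (auto intro!: eq_matI)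

lemma label_mat_upt: "A \<in> carrier_mat r c \<Longrightarrow> A = label_mat [0..<r] [0..<c] (\<lambda>i j. A $$ (i, j))"
  by (auto intro!: eq_matI)

lemma label_mat_nth:
  "label_mat L M f = label_mat L [0..<length M] (\<lambda>a j. f a (M ! j))"
  by (auto intro!: eq_matI)

text \<open>Distinct labels determine their positions, so the entries can be read as a function of
  labels.\<close>

lemma label_mat_exists:
  assumes "A \<in> carrier_mat (length L) (length M)" and "distinct L" and "distinct M"
  shows "\<exists>f. A = label_mat L M f"
proof
  have ix: "(SOME i. i < length K \<and> K ! i = K ! k) = k" if "distinct K" "k < length K"
    for K :: "'z list" and k
    using that by (intro some_equality) (auto simp: nth_eq_iff_index_eq)
  show "A = label_mat L M (\<lambda>a b. A $$ (SOME i. i < length L \<and> L ! i = a, SOME j. j < length M \<and> M ! j = b))"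
    using assms by (intro eq_matI) (auto simp: ix)
qed

text \<open>For distinct middle labels, indexing is a bijection from positions to labels, so the
  inner sum may run over a set of labels and be evaluated by case distinction on them.\<close>

lemma label_mat_mult:
  fixes f :: "'a \<Rightarrow> 'b \<Rightarrow> 'd :: semiring_0"
  assumes "distinct M"
  shows "label_mat L M f * label_mat M N g = label_mat L N (\<lambda>a c. \<Sum>b\<in>set M. f a b * g b c)"
proof (rule eq_matI)
  fix i j assume ij: "i < dim_row (label_mat L N (\<lambda>a c. \<Sum>b\<in>set M. f a b * g b c))"
    "j < dim_col (label_mat L N (\<lambda>a c. \<Sum>b\<in>set M. f a b * g b c))"
  have "(label_mat L M f * label_mat M N g) $$ (i, j)
      = (\<Sum>k = 0..<length M. f (L ! i) (M ! k) * g (M ! k) (N ! j))"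
    using ij by (auto simp: scalar_prod_def intro!: sum.cong)
  also have "\<dots> = (\<Sum>b\<in>set M. f (L ! i) b * g b (N ! j))"
    using assms by (intro sum.reindex_bij_betw) (auto simp: bij_betw_nth lessThan_atLeast0)
  finally show "(label_mat L M f * label_mat M N g) $$ (i, j)
      = label_mat L N (\<lambda>a c. \<Sum>b\<in>set M. f a b * g b c) $$ (i, j)"
    using ij by simp
qed auto

lemma label_mat_one:
  "distinct L \<Longrightarrow> label_mat L L (\<lambda>a b. if a = b then 1 else 0) = 1\<^sub>m (length L)"
  by (auto intro!: eq_matI simp: nth_eq_iff_index_eq)

section \<open>Kronecker products and block diagonals of labelled matrices\<close>

lemma label_mat_kronecker:
  "label_mat L M f \<otimes>\<^sub>K label_mat L' M' g
    = label_mat (list_Sigma L (\<lambda>_. L')) (list_Sigma M (\<lambda>_. M')) (\<lambda>(a, b) (c, d). f a c * g b d)"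
proof (rule eq_matI)
  let ?R = "label_mat (list_Sigma L (\<lambda>_. L')) (list_Sigma M (\<lambda>_. M')) (\<lambda>(a, b) (c, d). f a c * g b d)"
  fix i j assume "i < dim_row ?R" "j < dim_col ?R"
  then have ij: "i < length L * length L'" "j < length M * length M'"
    by (simp_all add: list_Sigma_const)
  \<comment> \<open>A valid index forces the inner lists to be nonempty, so quotient and remainder
    by their lengths recover the positions of the two labels of a pair.\<close>
  then have "0 < length L'" "0 < length M'"
    by (auto intro!: Nat.gr0I)
  then have "i div length L' < length L" "i mod length L' < length L'"
     "j div length M' < length M" "j mod length M' < length M'"
    using ij by (auto simp: less_mult_imp_div_less)
  with ij show "(label_mat L M f \<otimes>\<^sub>K label_mat L' M' g) $$ (i, j) = ?R $$ (i, j)"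
    by (simp add: kronecker_def list_Sigma_const product_nth)
qed (auto simp: kronecker_def list_Sigma_const)

lemma label_mat_append:
  "label_mat (L @ L') (M @ M') f
    = four_block_mat (label_mat L M f) (label_mat L M' f) (label_mat L' M f) (label_mat L' M' f)"
  by (rule eq_matI) (auto simp: four_block_mat_def Let_def nth_append)

text \<open>The added first label records the block, so an entry lies off the diagonal blocks
  exactly when the first labels differ. Blocks may be rectangular or empty.\<close>

lemma diag_block_label_mat:
  assumes "distinct L"
  shows "diag_block_mat (map (\<lambda>a. label_mat (M a) (N a) (f a)) L)
    = label_mat (list_Sigma L M) (list_Sigma L N)
        (\<lambda>(a, b) (a', b'). if a = a' then f a b b' else (0 :: 'd :: zero))"
  using assms
proof (induction L)
  case Nil
  then show ?case by (auto intro!: eq_matI)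
next
  case (Cons a L)
  let ?f = "\<lambda>(a, b) (a', b'). if a = a' then f a b b' else (0 :: 'd)"
  have *: "label_mat (map (Pair a) (M a)) (map (Pair a) (N a)) ?f = label_mat (M a) (N a) (f a)"
    by (simp add: label_mat_map)
  \<comment> \<open>Labels without a common first component never meet in a diagonal block; this
    covers both rectangles beside the block of \<open>a\<close>.\<close>
  have zero: "label_mat K K' ?f = 0\<^sub>m (length K) (length K')"
    if "fst ` set K \<inter> fst ` set K' = {}" for K K'
  proof -
    have "label_mat K K' ?f = label_mat K K' (\<lambda>_ _. 0)"
      using that by (intro label_mat_cong) (force split: prod.splits)
    then show ?thesis by (auto intro!: eq_matI)
  qed
  have "label_mat (map (Pair a) (M a)) (list_Sigma L N) ?f = 0\<^sub>m (length (M a)) (length (list_Sigma L N))"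
    using Cons.prems by (subst zero) force+
  moreover have "label_mat (list_Sigma L M) (map (Pair a) (N a)) ?f = 0\<^sub>m (length (list_Sigma L M)) (length (N a))"
    using Cons.prems by (subst zero) force+
  ultimately show ?case
    using Cons by (simp add: label_mat_append * Let_def)
qed

text \<open>A label \<open>(i, u, a)\<close> names the block, the copy and the place inside
  \<open>A i\<close>; the identity factor forces equal copies. This shape serves both
  \<open>ref_functor\<close> and the factor built from the gauge of \<open>F\<close>.\<close>

lemma diag_block_kronecker_left:
  assumes "\<And>i. i < n \<Longrightarrow> A i = label_mat (L i) (M i) (f i)"
  shows "diag_block_mat (map (\<lambda>i. 1\<^sub>m (r i) \<otimes>\<^sub>K A i) [0..<n])
    = label_mat (list_Sigma [0..<n] (\<lambda>i. list_Sigma [0..<r i] (\<lambda>_. L i)))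
        (list_Sigma [0..<n] (\<lambda>i. list_Sigma [0..<r i] (\<lambda>_. M i)))
        (\<lambda>(i, u, a) (i', u', b). if i = i' \<and> u = u' then f i a b else (0 :: 'd :: semiring_1))"
proof -
  have one: "1\<^sub>m k = label_mat [0..<k] [0..<k] (\<lambda>a b. if a = b then 1 else 0)" for k
    by (simp add: label_mat_one)
  have eq: "map (\<lambda>i. 1\<^sub>m (r i) \<otimes>\<^sub>K A i) [0..<n]
    = map (\<lambda>i. label_mat (list_Sigma [0..<r i] (\<lambda>_. L i)) (list_Sigma [0..<r i] (\<lambda>_. M i))
        (\<lambda>(u, a) (u', b). (if u = u' then 1 else 0) * f i a b)) [0..<n]"
    using assms by (auto simp: one label_mat_kronecker)
  show ?thesis
    unfolding eq by (subst diag_block_label_mat) (auto intro!: label_mat_cong)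
qed

text \<open>With the identity on the right, \<open>B j\<close> acts on the copy label
  \<open>t\<close> while \<open>x\<close> is kept. The labels have the shape of those in
  \<open>ref_basis\<close>, so such matrices can be multiplied with values of
  \<open>ref_functor\<close>.\<close>

lemma diag_block_kronecker_right:
  assumes "\<And>j. j < n \<Longrightarrow> B j \<in> carrier_mat (r j) (r j)"
  shows "diag_block_mat (map (\<lambda>j. B j \<otimes>\<^sub>K 1\<^sub>m (c j)) [0..<n])
    = label_mat (list_Sigma [0..<n] (\<lambda>j. list_Sigma [0..<r j] (\<lambda>_. [0..<c j])))
        (list_Sigma [0..<n] (\<lambda>j. list_Sigma [0..<r j] (\<lambda>_. [0..<c j])))
        (\<lambda>(j, t, x) (j', t', x'). if j = j' \<and> x = x' then B j $$ (t, t') else (0 :: 'd :: semiring_1))"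
proof -
  have one: "1\<^sub>m k = label_mat [0..<k] [0..<k] (\<lambda>a b. if a = b then 1 else 0)" for k
    by (simp add: label_mat_one)
  have eq: "map (\<lambda>j. B j \<otimes>\<^sub>K 1\<^sub>m (c j)) [0..<n]
    = map (\<lambda>j. label_mat (list_Sigma [0..<r j] (\<lambda>_. [0..<c j])) (list_Sigma [0..<r j] (\<lambda>_. [0..<c j]))
        (\<lambda>(t, x) (t', x'). B j $$ (t, t') * (if x = x' then 1 else 0))) [0..<n]"
    using label_mat_upt[OF assms] by (auto simp: one simp flip: label_mat_kronecker)
  show ?thesis
    unfolding eq by (subst diag_block_label_mat) (auto intro!: label_mat_cong)
qed

section \<open>Two-sided inverses of matrices\<close>

lemma mat_inv_mult:
  assumes "A \<in> carrier_mat d d" and "invertible_mat A"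
  shows "A * mat_inv A = 1\<^sub>m d" and "mat_inv A * A = 1\<^sub>m d" and "mat_inv A \<in> carrier_mat d d"
proof -
  obtain B where B: "A * B = 1\<^sub>m d" "B * A = 1\<^sub>m (dim_row B)"
    using assms by (auto simp: invertible_mat_def inverts_mat_def)
  \<comment> \<open>\<open>invertible_mat\<close> leaves the size of the inverse open. Comparing
    dimensions in the two products shows that it is square, so \<open>A\<close> is a unit of the
    matrix ring and \<open>mat_inverse\<close> cannot return \<open>None\<close>.\<close>
  then have "dim_col B = d" "dim_row B = d"
    using assms(1) by (metis carrier_matD index_mult_mat(3) index_one_mat(3))+
  with assms(1) B have "A \<in> Units (ring_mat TYPE(complex) d ())"
    unfolding Units_def by (auto simp: ring_mat_simps)
  with mat_inverse(1)[OF assms(1), where b = "()"] obtain C where "mat_inverse A = Some C"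
    by (cases "mat_inverse A") auto
  with mat_inverse(2)[OF assms(1) this]
  show "A * mat_inv A = 1\<^sub>m d" "mat_inv A * A = 1\<^sub>m d" "mat_inv A \<in> carrier_mat d d"
    by auto
qed

lemma mat_inv_eqI:
  assumes A: "A \<in> carrier_mat d d" and B: "B \<in> carrier_mat d d"
    and AB: "A * B = 1\<^sub>m d" and BA: "B * A = 1\<^sub>m d"
  shows "mat_inv A = B"
proof -
  have "invertible_mat A"
    using assms by (auto simp: invertible_mat_def inverts_mat_def)
  note inv = mat_inv_mult[OF A this]
  have "mat_inv A = (B * A) * mat_inv A"
    using BA inv(3) by simp
  also have "\<dots> = B * (A * mat_inv A)"
    by (rule assoc_mult_mat[OF B A inv(3)])
  finally show ?thesis
    using B inv(1) by simp
qed

text \<open>Compare the traces of the two products.\<close>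

lemma invertible_rectangular_square:
  fixes A B :: "'a :: {comm_semiring_1, semiring_char_0} mat"
  assumes A: "A \<in> carrier_mat p q" and B: "B \<in> carrier_mat q p"
    and AB: "A * B = 1\<^sub>m p" and BA: "B * A = 1\<^sub>m q"
  shows "p = q"
proof -
  have "(of_nat p :: 'a) = (\<Sum>i = 0..<p. (A * B) $$ (i, i))"
    by (simp add: AB)
  also have "\<dots> = (\<Sum>i = 0..<p. \<Sum>k = 0..<q. A $$ (i, k) * B $$ (k, i))"
    using A B by (auto simp: scalar_prod_def intro!: sum.cong)
  also have "\<dots> = (\<Sum>k = 0..<q. \<Sum>i = 0..<p. B $$ (k, i) * A $$ (i, k))"
    by (subst sum.swap) (simp add: mult.commute)
  also have "\<dots> = (\<Sum>k = 0..<q. (B * A) $$ (k, k))"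
    using A B by (auto simp: scalar_prod_def intro!: sum.cong)
  also have "\<dots> = of_nat q"
    by (simp add: BA)
  finally show ?thesis by simp
qed

section \<open>The reference functor\<close>

text \<open>A label \<open>(j, u, x)\<close> is basis vector \<open>x\<close> in copy
  \<open>u\<close> of the \<open>j\<close>-th space, listed in the order in which the blocks of
  \<open>H(r)\<close> stand.\<close>

definition ref_basis :: "nat vec \<Rightarrow> nat vec \<Rightarrow> (nat \<times> nat \<times> nat) list" where
  "ref_basis r a = list_Sigma [0..<dim_vec r] (\<lambda>j. list_Sigma [0..<r $ j] (\<lambda>_. [0..<a $ j]))"

abbreviation ref_mor :: "nat vec \<Rightarrow> complex mat list \<Rightarrow> complex mat" where
  "ref_mor r fs \<equiv> on_mor (ref_functor r) fs ! 0"

text \<open>The inclusion of the line spanned by basis vector \<open>x\<close> of component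
  \<open>j\<close>. Every other component starts at the zero space, so its matrix has no
  columns.\<close>

definition inj_mor :: "nat \<Rightarrow> nat vec \<Rightarrow> nat \<Rightarrow> nat \<Rightarrow> complex mat list" where
  "inj_mor n a j x =
     map (\<lambda>k. mat (a $ k) (unit_vec n j $ k) (\<lambda>(y, z). if k = j \<and> y = x then 1 else 0)) [0..<n]"

definition proj_mor :: "nat \<Rightarrow> nat vec \<Rightarrow> nat \<Rightarrow> nat \<Rightarrow> complex mat list" where
  "proj_mor n a j x =
     map (\<lambda>k. mat (unit_vec n j $ k) (a $ k) (\<lambda>(z, y). if k = j \<and> y = x then 1 else 0)) [0..<n]"

lemma distinct_ref_basis [simp]: "distinct (ref_basis r a)"
  unfolding ref_basis_def by (intro distinct_list_Sigma) auto

lemma length_ref_basis [simp]: "length (ref_basis r a) = a \<bullet> r"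
  by (auto simp: ref_basis_def length_list_Sigma scalar_prod_def interv_sum_list_conv_sum_set_nat
      sum_list_triv mult.commute intro!: sum.cong)

lemma set_ref_basis: "set (ref_basis r a) = {(j, u, x). j < dim_vec r \<and> u < r $ j \<and> x < a $ j}"
  by (auto simp: ref_basis_def)

lemma mem_ref_basis: "(j, u, x) \<in> set (ref_basis r a) \<longleftrightarrow> j < dim_vec r \<and> u < r $ j \<and> x < a $ j"
  by (simp add: set_ref_basis)

lemma ref_basis_unit_vec:
  assumes "r \<in> carrier_vec n" and "j < n"
  shows "ref_basis r (unit_vec n j) = map (\<lambda>u. (j, u, 0)) [0..<r $ j]"
proof -
  \<comment> \<open>The innermost list is \<open>[0..<1]\<close> for component \<open>j\<close> and
    \<open>[0..<0]\<close> for the others; these two facts evaluate the nested enumeration in either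
    case.\<close>
  have "concat (map (\<lambda>a. []) xs) = []" "concat (map (\<lambda>a. [g a]) xs) = map g xs"
    for xs :: "'x list" and g :: "'x \<Rightarrow> 'y"
    by (induction xs) auto
  then have "ref_basis r (unit_vec n j)
      = list_Sigma [0..<n] (\<lambda>k. if k = j then map (\<lambda>u. (u, 0)) [0..<r $ j] else [])"
    using assms unfolding ref_basis_def
    by (auto simp: list_Sigma_def[of "[0..<r $ _]"] intro!: list_Sigma_cong)
  then show ?thesis
    using assms by (simp add: list_Sigma_single)
qed

section \<open>Componentwise operations on morphisms\<close>

lemma svect_hom_nth: "fs \<in> svect_hom n a a' \<Longrightarrow> j < n \<Longrightarrow> fs ! j \<in> carrier_mat (a' $ j) (a $ j)"
  by (simp add: svect_hom_def)

lemma svect_comp_hom: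
  "fs \<in> svect_hom n a a' \<Longrightarrow> gs \<in> svect_hom n a' a'' \<Longrightarrow> svect_comp gs fs \<in> svect_hom n a a''"
  by (auto simp: svect_hom_def svect_comp_def)

lemma svect_comp_nth:
  "fs \<in> svect_hom n a a' \<Longrightarrow> gs \<in> svect_hom n a' a'' \<Longrightarrow> j < n \<Longrightarrow> svect_comp gs fs ! j = gs ! j * fs ! j"
  by (auto simp: svect_hom_def svect_comp_def)

lemma svect_add_nth:
  "fs \<in> svect_hom n a a' \<Longrightarrow> gs \<in> svect_hom n a a' \<Longrightarrow> j < n \<Longrightarrow> svect_add fs gs ! j = fs ! j + gs ! j"
  by (auto simp: svect_hom_def svect_add_def)

lemma svect_smult_nth:
  "fs \<in> svect_hom n a a' \<Longrightarrow> j < n \<Longrightarrow> svect_smult c fs ! j = c \<cdot>\<^sub>m fs ! j"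
  by (auto simp: svect_hom_def svect_smult_def)

lemma svect_id_hom: "svect_id n a \<in> svect_hom n a a"
  by (auto simp: svect_hom_def svect_id_def)

lemma inj_mor_hom: "inj_mor n a j x \<in> svect_hom n (unit_vec n j) a"
  by (auto simp: svect_hom_def inj_mor_def)

lemma proj_mor_hom: "proj_mor n a j x \<in> svect_hom n a (unit_vec n j)"
  by (auto simp: svect_hom_def proj_mor_def)

lemma inj_mor_unit_vec: "j < n \<Longrightarrow> inj_mor n (unit_vec n j) j 0 = svect_id n (unit_vec n j)"
  by (auto simp: inj_mor_def svect_id_def intro!: eq_matI)

section \<open>Values of the reference functor in labelled bases\<close>

lemma ref_mor_eq:
  assumes r: "r \<in> carrier_vec n" and fs: "fs \<in> svect_hom n a a'"
  shows "ref_mor r fs = label_mat (ref_basis r a') (ref_basis r a)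
    (\<lambda>(j, u, y) (j', u', x). if j = j' \<and> u = u' then fs ! j $$ (y, x) else 0)"
proof -
  have "ref_mor r fs = diag_block_mat (map (\<lambda>j. 1\<^sub>m (r $ j) \<otimes>\<^sub>K fs ! j) [0..<n])"
    using r by (auto simp: ref_functor_def)
  also have "\<dots> = label_mat (ref_basis r a') (ref_basis r a)
    (\<lambda>(j, u, y) (j', u', x). if j = j' \<and> u = u' then fs ! j $$ (y, x) else 0)"
    using r label_mat_upt[OF svect_hom_nth[OF fs]] by (subst diag_block_kronecker_left) (auto simp: ref_basis_def)
  finally show ?thesis .
qed

lemma ref_mor_carrier:
  "r \<in> carrier_vec n \<Longrightarrow> fs \<in> svect_hom n a a' \<Longrightarrow> ref_mor r fs \<in> carrier_mat (a' \<bullet> r) (a \<bullet> r)"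
  using label_mat_carrier[of "ref_basis r a'" "ref_basis r a"] by (simp add: ref_mor_eq)

text \<open>Column \<open>t\<close> is the unit vector at \<open>(j, t, x)\<close>, so right
  multiplication by this matrix extracts the columns with these labels.\<close>

lemma ref_mor_inj:
  assumes r: "r \<in> carrier_vec n" and j: "j < n" and x: "x < a $ j"
  shows "ref_mor r (inj_mor n a j x) = label_mat (ref_basis r a) [0..<r $ j]
    (\<lambda>k t. if k = (j, t, x) then 1 else 0)"
  unfolding ref_mor_eq[OF r inj_mor_hom] ref_basis_unit_vec[OF r j] label_mat_map_col
  using r j x by (intro label_mat_cong) (auto simp: set_ref_basis inj_mor_def split: if_splits)

text \<open>As \<open>j\<close> and \<open>x\<close> vary, the extracted columns run through all
  labels of \<open>ref_basis r a\<close>, so the two matrices agree column by column.\<close>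

lemma ref_mor_inj_cancel:
  assumes r: "r \<in> carrier_vec n"
    and X: "X \<in> carrier_mat d (a \<bullet> r)" and Y: "Y \<in> carrier_mat d (a \<bullet> r)"
    and eq: "\<And>j x. j < n \<Longrightarrow> x < a $ j \<Longrightarrow> X * ref_mor r (inj_mor n a j x) = Y * ref_mor r (inj_mor n a j x)"
  shows "X = Y"
proof -
  obtain f where f: "X = label_mat [0..<d] (ref_basis r a) f"
    using label_mat_exists[of X "[0..<d]" "ref_basis r a"] X by auto
  obtain g where g: "Y = label_mat [0..<d] (ref_basis r a) g"
    using label_mat_exists[of Y "[0..<d]" "ref_basis r a"] Y by auto
  have col: "label_mat [0..<d] (ref_basis r a) h * ref_mor r (inj_mor n a j x)
      = label_mat [0..<d] [0..<r $ j] (\<lambda>p t. h p (j, t, x))" if "j < n" "x < a $ j" for h j x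
    unfolding ref_mor_inj[OF r that] label_mat_mult[OF distinct_ref_basis]
    using r that by (intro label_mat_cong) (auto simp: mem_ref_basis if_distrib cong: if_cong)
  have "f p (j, t, x) = g p (j, t, x)" if "p < d" "j < n" "t < r $ j" "x < a $ j" for p j t x
    using eq[OF that(2,4)] that unfolding f g col[OF that(2,4)] label_mat_eq_iff by auto
  then show ?thesis
    unfolding f g using r by (intro label_mat_cong) (auto simp: set_ref_basis)
qed

section \<open>The gauge of a linear functor\<close>

lemma dim_rank_matrix [simp]: "dim_row (rank_matrix n m F) = m" "dim_col (rank_matrix n m F) = n"
  by (simp_all add: rank_matrix_def)

lemma index_rank_matrix:
  "i < m \<Longrightarrow> j < n \<Longrightarrow> rank_matrix n m F $$ (i, j) = on_obj F (unit_vec n j) $ i"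
  by (simp add: rank_matrix_def)

locale linear_svect_functor =
  fixes n m :: nat and F :: svect_functor
  assumes linear: "is_linear_functor n m F"
begin

abbreviation "rk i \<equiv> row (rank_matrix n m F) i"

section \<open>Functoriality and linearity in components\<close>

lemma on_obj_carrier: "a \<in> carrier_vec n \<Longrightarrow> on_obj F a \<in> carrier_vec m"
  using linear by (auto simp: is_linear_functor_def is_functor_def)

lemma on_mor_hom:
  "a \<in> carrier_vec n \<Longrightarrow> a' \<in> carrier_vec n \<Longrightarrow> fs \<in> svect_hom n a a'
    \<Longrightarrow> on_mor F fs \<in> svect_hom m (on_obj F a) (on_obj F a')"
  using linear by (auto simp: is_linear_functor_def is_functor_def)

lemma on_mor_id:
  "a \<in> carrier_vec n \<Longrightarrow> on_mor F (svect_id n a) = svect_id m (on_obj F a)"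
  using linear by (auto simp: is_linear_functor_def is_functor_def)

lemma on_mor_id_nth:
  "a \<in> carrier_vec n \<Longrightarrow> i < m \<Longrightarrow> on_mor F (svect_id n a) ! i = 1\<^sub>m (on_obj F a $ i)"
  by (subst on_mor_id) (auto simp: svect_id_def)

lemma on_mor_comp:
  "a \<in> carrier_vec n \<Longrightarrow> a' \<in> carrier_vec n \<Longrightarrow> a'' \<in> carrier_vec n
    \<Longrightarrow> fs \<in> svect_hom n a a' \<Longrightarrow> gs \<in> svect_hom n a' a''
    \<Longrightarrow> on_mor F (svect_comp gs fs) = svect_comp (on_mor F gs) (on_mor F fs)"
  using linear unfolding is_linear_functor_def is_functor_def by blast

lemma on_mor_add:
  "a \<in> carrier_vec n \<Longrightarrow> a' \<in> carrier_vec n \<Longrightarrow> fs \<in> svect_hom n a a' \<Longrightarrow> gs \<in> svect_hom n a a'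
    \<Longrightarrow> on_mor F (svect_add fs gs) = svect_add (on_mor F fs) (on_mor F gs)"
  using linear unfolding is_linear_functor_def by blast

lemma on_mor_smult:
  "a \<in> carrier_vec n \<Longrightarrow> a' \<in> carrier_vec n \<Longrightarrow> fs \<in> svect_hom n a a'
    \<Longrightarrow> on_mor F (svect_smult c fs) = svect_smult c (on_mor F fs)"
  using linear unfolding is_linear_functor_def by blast

lemma on_mor_nth_carrier:
  "a \<in> carrier_vec n \<Longrightarrow> a' \<in> carrier_vec n \<Longrightarrow> fs \<in> svect_hom n a a' \<Longrightarrow> i < m
    \<Longrightarrow> on_mor F fs ! i \<in> carrier_mat (on_obj F a' $ i) (on_obj F a $ i)"
  by (rule svect_hom_nth[OF on_mor_hom])

lemma on_mor_comp_nth: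
  "a \<in> carrier_vec n \<Longrightarrow> a' \<in> carrier_vec n \<Longrightarrow> a'' \<in> carrier_vec n
    \<Longrightarrow> fs \<in> svect_hom n a a' \<Longrightarrow> gs \<in> svect_hom n a' a'' \<Longrightarrow> i < m
    \<Longrightarrow> on_mor F (svect_comp gs fs) ! i = on_mor F gs ! i * on_mor F fs ! i"
  by (simp add: on_mor_comp svect_comp_nth[OF on_mor_hom on_mor_hom])

lemma rank_matrix_carrier: "rank_matrix n m F \<in> carrier_mat m n"
  by (simp add: rank_matrix_def)

lemma rk_carrier: "rk i \<in> carrier_vec n"
  by (intro carrier_vecI) simp

text \<open>Additivity iterated over a finite index set. The summed morphism is given by its
  dimensions and entries, so that the empty sum is a zero morphism of the right type.\<close>

lemma on_mor_sum:
  assumes a: "a \<in> carrier_vec n" and a': "a' \<in> carrier_vec n" and "finite I"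
    and fs: "\<And>l. l \<in> I \<Longrightarrow> fs l \<in> svect_hom n a a'"
    and i: "i < m" and p: "p < on_obj F a' $ i" and q: "q < on_obj F a $ i"
  shows "on_mor F (map (\<lambda>j. mat (a' $ j) (a $ j) (\<lambda>k. \<Sum>l\<in>I. fs l ! j $$ k)) [0..<n]) ! i $$ (p, q)
    = (\<Sum>l\<in>I. on_mor F (fs l) ! i $$ (p, q))"
  using \<open>finite I\<close> fs
proof (induction I)
  case empty
  let ?z = "map (\<lambda>j. mat (a' $ j) (a $ j) (\<lambda>k. 0 :: complex)) [0..<n]"
  have z: "?z \<in> svect_hom n a a'"
    by (simp add: svect_hom_def)
  \<comment> \<open>The zero morphism is zero times itself, so homogeneity sends it to zero.\<close>
  have "?z = svect_smult 0 ?z"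
    by (auto simp: svect_smult_def intro!: eq_matI)
  then have "on_mor F ?z ! i = on_mor F (svect_smult 0 ?z) ! i"
    by (rule arg_cong)
  also have "\<dots> = 0 \<cdot>\<^sub>m on_mor F ?z ! i"
    unfolding on_mor_smult[OF a a' z] by (rule svect_smult_nth[OF on_mor_hom[OF a a' z] i])
  finally have "on_mor F ?z ! i $$ (p, q) = (0 \<cdot>\<^sub>m on_mor F ?z ! i) $$ (p, q)"
    by (rule arg_cong)
  also have "\<dots> = 0"
    using on_mor_nth_carrier[OF a a' z i] p q by auto
  finally show ?case by simp
next
  case (insert l I)
  let ?g = "map (\<lambda>j. mat (a' $ j) (a $ j) (\<lambda>k. \<Sum>l\<in>I. fs l ! j $$ k)) [0..<n]"
  have g: "?g \<in> svect_hom n a a'"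
    by (simp add: svect_hom_def)
  have f: "fs l \<in> svect_hom n a a'"
    using insert.prems by simp
  have "map (\<lambda>j. mat (a' $ j) (a $ j) (\<lambda>k. \<Sum>l\<in>insert l I. fs l ! j $$ k)) [0..<n] = svect_add (fs l) ?g"
    using insert.hyps f svect_hom_nth[OF f]
    by (intro nth_equalityI) (auto simp: svect_add_def svect_hom_def intro!: eq_matI)
  then have "on_mor F (map (\<lambda>j. mat (a' $ j) (a $ j) (\<lambda>k. \<Sum>l\<in>insert l I. fs l ! j $$ k)) [0..<n]) ! i
      = on_mor F (fs l) ! i + on_mor F ?g ! i"
    by (simp add: on_mor_add[OF a a' f g] svect_add_nth[OF on_mor_hom[OF a a' f] on_mor_hom[OF a a' g] i])
  then show ?case
    using insert on_mor_nth_carrier[OF a a' f i] on_mor_nth_carrier[OF a a' g i] p q by auto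
qed

section \<open>The candidate gauge and its inverse\<close>

definition gauge_mat :: "nat \<Rightarrow> nat vec \<Rightarrow> complex mat" where
  "gauge_mat i a = label_mat [0..<on_obj F a $ i] (ref_basis (rk i) a)
     (\<lambda>p (j, u, x). on_mor F (inj_mor n a j x) ! i $$ (p, u))"

text \<open>Rows of the images of projections, where \<open>gauge_mat\<close> takes columns of the
  images of inclusions. Both are rectangular a priori: \<open>on_obj F a $ i\<close> equals
  \<open>a \<bullet> rk i\<close> only as a consequence of their being mutually inverse.\<close>

definition gauge_inv_mat :: "nat \<Rightarrow> nat vec \<Rightarrow> complex mat" where
  "gauge_inv_mat i a = label_mat (ref_basis (rk i) a) [0..<on_obj F a $ i]
     (\<lambda>(j, u, x) p. on_mor F (proj_mor n a j x) ! i $$ (u, p))"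

text \<open>The composite goes from \<open>C(j',n)\<close> to \<open>C(j,n)\<close>. The all-ones
  morphism is the identity if \<open>j = j'\<close> and consists of empty matrices otherwise, so one
  formula covers both cases.\<close>

lemma proj_comp_inj:
  assumes fs: "fs \<in> svect_hom n a a'" and j: "j < n" "y < a' $ j" and j': "j' < n" "x < a $ j'"
  shows "svect_comp (proj_mor n a' j y) (svect_comp fs (inj_mor n a j' x))
    = svect_smult (if j = j' then fs ! j $$ (y, x) else 0)
        (map (\<lambda>k. mat (unit_vec n j $ k) (unit_vec n j' $ k) (\<lambda>_. 1)) [0..<n])"
    (is "?L = svect_smult _ ?Z")
proof (rule nth_equalityI)
  have L: "?L \<in> svect_hom n (unit_vec n j') (unit_vec n j)"
    by (rule svect_comp_hom[OF svect_comp_hom[OF inj_mor_hom fs] proj_mor_hom])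
  then show "length ?L = length (svect_smult (if j = j' then fs ! j $$ (y, x) else 0) ?Z)"
    by (simp add: svect_hom_def svect_smult_def)
  fix k assume "k < length ?L"
  with L have k: "k < n" by (simp add: svect_hom_def)
  have "?L ! k = proj_mor n a' j y ! k * (fs ! k * inj_mor n a j' x ! k)"
    by (simp add: svect_comp_nth[OF svect_comp_hom[OF inj_mor_hom fs] proj_mor_hom k]
        svect_comp_nth[OF inj_mor_hom fs k])
  moreover have "\<dots> = svect_smult (if j = j' then fs ! j $$ (y, x) else 0) ?Z ! k" (is "_ = ?R")
  proof (rule eq_matI)
    fix z w assume zw: "z < dim_row ?R" "w < dim_col ?R"
    \<comment> \<open>An entry exists only where both unit vectors are nonzero, which leaves a
      single 1-by-1 component.\<close>
    then have eq: "k = j" "j' = j" "z = 0" "w = 0"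
      using k j j' by (auto simp: svect_smult_def split: if_splits)
    have proj: "(proj_mor n a' j y ! j * M) $$ (0, 0) = M $$ (y, 0)" if "M \<in> carrier_mat (a' $ j) 1" for M
      using that j by (auto simp: proj_mor_def scalar_prod_def if_distrib if_distribR cong: if_cong)
    have inj: "inj_mor n a j x ! j \<in> carrier_mat (a $ j) 1"
      using j by (simp add: inj_mor_def)
    have "(proj_mor n a' j y ! j * (fs ! j * inj_mor n a j x ! j)) $$ (0, 0)
        = (fs ! j * inj_mor n a j x ! j) $$ (y, 0)"
      using svect_hom_nth[OF fs j(1)] inj by (intro proj) auto
    also have "\<dots> = fs ! j $$ (y, x)"
      using svect_hom_nth[OF fs j(1)] j j'
      by (auto simp: eq inj_mor_def scalar_prod_def if_distrib cong: if_cong)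
    finally show "(proj_mor n a' j y ! k * (fs ! k * inj_mor n a j' x ! k)) $$ (z, w) = ?R $$ (z, w)"
      using j by (simp add: eq svect_smult_def)
  qed (use k svect_hom_nth[OF fs k] in \<open>auto simp: proj_mor_def inj_mor_def svect_smult_def\<close>)
  ultimately show "?L ! k = svect_smult (if j = j' then fs ! j $$ (y, x) else 0) ?Z ! k"
    by simp
qed

text \<open>By functoriality an entry of the product is an entry of the image of a projection after
  \<open>fs\<close> after an inclusion; \<open>proj_comp_inj\<close> and linearity then evaluate it.
  This is the gauge equation before inverses are available, and at an identity morphism it yields
  one of the two inverse laws.\<close>

lemma gauge_mat_naturality:
  assumes i: "i < m" and a: "a \<in> carrier_vec n" and a': "a' \<in> carrier_vec n"
    and fs: "fs \<in> svect_hom n a a'"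
  shows "gauge_inv_mat i a' * (on_mor F fs ! i * gauge_mat i a) = ref_mor (rk i) fs"
proof -
  let ?d = "on_obj F a $ i" and ?d' = "on_obj F a' $ i"
  note carrier = on_mor_nth_carrier[OF _ _ _ i]
  have "gauge_inv_mat i a' * (on_mor F fs ! i * gauge_mat i a)
    = label_mat (ref_basis (rk i) a') (ref_basis (rk i) a)
      (\<lambda>k l. \<Sum>p = 0..<?d'. (case k of (j, u, y) \<Rightarrow> on_mor F (proj_mor n a' j y) ! i $$ (u, p)) *
        (\<Sum>q = 0..<?d. on_mor F fs ! i $$ (p, q) *
          (case l of (j', u', x) \<Rightarrow> on_mor F (inj_mor n a j' x) ! i $$ (q, u'))))"
    unfolding gauge_inv_mat_def gauge_mat_def
    by (subst label_mat_upt[OF carrier[OF a a' fs]]) (auto simp: label_mat_mult intro!: label_mat_cong)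
  also have "\<dots> = ref_mor (rk i) fs"
    unfolding ref_mor_eq[OF rk_carrier fs]
  proof (rule label_mat_cong, clarify)
    fix j u y j' u' x
    assume "(j, u, y) \<in> set (ref_basis (rk i) a')" "(j', u', x) \<in> set (ref_basis (rk i) a)"
    then have j: "j < n" "y < a' $ j" and j': "j' < n" "x < a $ j'" and
      u: "u < on_obj F (unit_vec n j) $ i" "u' < on_obj F (unit_vec n j') $ i"
      using i rk_carrier[of i] by (auto simp: mem_ref_basis index_rank_matrix)
    let ?P = "on_mor F (proj_mor n a' j y) ! i" and ?J = "on_mor F (inj_mor n a j' x) ! i"
    let ?Z = "map (\<lambda>k. mat (unit_vec n j $ k) (unit_vec n j' $ k) (\<lambda>_. 1 :: complex)) [0..<n]"
    let ?c = "if j = j' then fs ! j $$ (y, x) else 0"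
    have Z: "?Z \<in> svect_hom n (unit_vec n j') (unit_vec n j)"
      by (simp add: svect_hom_def)
    have P: "?P \<in> carrier_mat (on_obj F (unit_vec n j) $ i) ?d'"
      and J: "?J \<in> carrier_mat ?d (on_obj F (unit_vec n j') $ i)"
      using a a' by (auto intro!: carrier inj_mor_hom proj_mor_hom)
    note f = carrier[OF a a' fs]
    have "(\<Sum>p = 0..<?d'. ?P $$ (u, p) * (\<Sum>q = 0..<?d. on_mor F fs ! i $$ (p, q) * ?J $$ (q, u')))
        = (?P * (on_mor F fs ! i * ?J)) $$ (u, u')"
      using P J f u by (auto simp: scalar_prod_def intro!: sum.cong)
    also have "?P * (on_mor F fs ! i * ?J)
        = on_mor F (svect_comp (proj_mor n a' j y) (svect_comp fs (inj_mor n a j' x))) ! i"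
      using a a' on_mor_comp_nth[OF _ a _ inj_mor_hom fs i]
        on_mor_comp_nth[OF _ a' _ svect_comp_hom[OF inj_mor_hom fs] proj_mor_hom i] by simp
    also have "\<dots> = on_mor F (svect_smult ?c ?Z) ! i"
      by (simp add: proj_comp_inj[OF fs j j'])
    also have "\<dots> = ?c \<cdot>\<^sub>m on_mor F ?Z ! i"
      using svect_smult_nth[OF on_mor_hom[OF _ _ Z] i] on_mor_smult[OF _ _ Z] by simp
    also have "\<dots> $$ (u, u') = ?c * on_mor F ?Z ! i $$ (u, u')"
      using carrier[OF _ _ Z] u by simp
    also have "\<dots> = (if j = j' \<and> u = u' then fs ! j $$ (y, x) else 0)"
    \<comment> \<open>For equal components the all-ones morphism is an identity, which gives the
      condition \<open>u = u'\<close>; for different ones the scalar is zero.\<close>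
    proof (cases "j = j'")
      case True
      have Z_id: "?Z = svect_id n (unit_vec n j)"
        using True j j' by (auto simp: svect_id_def intro!: eq_matI split: if_splits)
      have "on_mor F ?Z ! i = 1\<^sub>m (on_obj F (unit_vec n j) $ i)"
        unfolding Z_id by (rule on_mor_id_nth) (use i in auto)
      then show ?thesis
        using u True by simp
    qed simp
    finally show "(\<Sum>p = 0..<?d'. ?P $$ (u, p) * (\<Sum>q = 0..<?d. on_mor F fs ! i $$ (p, q) * ?J $$ (q, u')))
      = (if j = j' \<and> u = u' then fs ! j $$ (y, x) else 0)" .
  qed
  finally show ?thesis .
qed

text \<open>The resolution of the identity into rank-one idempotents, in the form that
  \<open>on_mor_sum\<close> takes as input.\<close>

lemma sum_inj_comp_proj:
  assumes a: "a \<in> carrier_vec n"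
  shows "map (\<lambda>k. mat (a $ k) (a $ k)
      (\<lambda>e. \<Sum>(j, x)\<in>(SIGMA j:{..<n}. {..<a $ j}). svect_comp (inj_mor n a j x) (proj_mor n a j x) ! k $$ e)) [0..<n]
    = svect_id n a"
proof -
  have "(\<Sum>(j, x)\<in>(SIGMA j:{..<n}. {..<a $ j}). svect_comp (inj_mor n a j x) (proj_mor n a j x) ! k $$ (y, z))
      = (if y = z then 1 else 0)" if k: "k < n" and y: "y < a $ k" and z: "z < a $ k" for k y z
  proof -
    \<comment> \<open>Each summand is a diagonal matrix unit, so row \<open>y\<close> of component
      \<open>k\<close> sees only the pair \<open>(k, y)\<close>.\<close>
    have "svect_comp (inj_mor n a j x) (proj_mor n a j x) ! k $$ (y, z)
        = (if (j, x) = (k, y) then (if y = z then 1 else 0) else 0)"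
      if "j < n" "x < a $ j" for j x
      using that k y z unfolding svect_comp_nth[OF proj_mor_hom inj_mor_hom k]
      by (cases "j = k") (auto simp: inj_mor_def proj_mor_def scalar_prod_def)
    then have "(\<Sum>(j, x)\<in>(SIGMA j:{..<n}. {..<a $ j}). svect_comp (inj_mor n a j x) (proj_mor n a j x) ! k $$ (y, z))
      = (\<Sum>jx\<in>(SIGMA j:{..<n}. {..<a $ j}). if jx = (k, y) then (if y = z then 1 else 0) else 0)"
      by (intro sum.cong) (auto simp: prod_eq_iff)
    also have "\<dots> = (if y = z then 1 else 0)"
      using k y by (subst sum.delta) auto
    finally show ?thesis .
  qed
  then show ?thesis
    by (auto simp: svect_id_def intro!: eq_matI)
qed

text \<open>Summing over the copy label \<open>u\<close> composes the images of an inclusion and its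
  projection; the remaining sum over \<open>(j, x)\<close> is the image of the resolution of the
  identity.\<close>

lemma gauge_mat_mult_inv:
  assumes i: "i < m" and a: "a \<in> carrier_vec n"
  shows "gauge_mat i a * gauge_inv_mat i a = 1\<^sub>m (on_obj F a $ i)"
proof (rule eq_matI)
  let ?d = "on_obj F a $ i"
  let ?S = "SIGMA j:{..<n}. {..<a $ j}"
  note carrier = on_mor_nth_carrier[OF _ _ _ i]
  fix p q assume "p < dim_row (1\<^sub>m ?d)" "q < dim_col (1\<^sub>m ?d)"
  then have pq: "p < ?d" "q < ?d" by auto
  let ?f = "\<lambda>j u x. on_mor F (inj_mor n a j x) ! i $$ (p, u) * on_mor F (proj_mor n a j x) ! i $$ (u, q)"
  have "(gauge_mat i a * gauge_inv_mat i a) $$ (p, q) = (\<Sum>(j, u, x)\<in>set (ref_basis (rk i) a). ?f j u x)"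
    using pq unfolding gauge_mat_def gauge_inv_mat_def
    by (simp add: label_mat_mult case_prod_unfold)
  also have "set (ref_basis (rk i) a) = (SIGMA j:{..<n}. {..<rk i $ j} \<times> {..<a $ j})"
    using rk_carrier[of i] by (auto simp: set_ref_basis)
  also have "(\<Sum>(j, u, x)\<in>\<dots>. ?f j u x) = (\<Sum>j<n. \<Sum>u<rk i $ j. \<Sum>x<a $ j. ?f j u x)"
    by (simp add: sum.Sigma case_prod_unfold flip: sum.cartesian_product)
  also have "\<dots> = (\<Sum>j<n. \<Sum>x<a $ j. \<Sum>u<rk i $ j. ?f j u x)"
    by (intro sum.cong refl sum.swap)
  also have "\<dots> = (\<Sum>j<n. \<Sum>x<a $ j. on_mor F (svect_comp (inj_mor n a j x) (proj_mor n a j x)) ! i $$ (p, q))"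
  proof (intro sum.cong refl)
    fix j x assume "j \<in> {..<n}"
    then have j: "j < n" by simp
    have "on_mor F (svect_comp (inj_mor n a j x) (proj_mor n a j x)) ! i
        = on_mor F (inj_mor n a j x) ! i * on_mor F (proj_mor n a j x) ! i"
      using a by (intro on_mor_comp_nth[OF _ _ _ proj_mor_hom inj_mor_hom i]) auto
    then show "(\<Sum>u<rk i $ j. ?f j u x) = on_mor F (svect_comp (inj_mor n a j x) (proj_mor n a j x)) ! i $$ (p, q)"
      using pq j i carrier[OF _ _ inj_mor_hom, of j a x] carrier[OF _ _ proj_mor_hom, of a j x] a
      by (auto simp: scalar_prod_def index_rank_matrix lessThan_atLeast0 intro!: sum.cong)
  qed
  also have "\<dots> = (\<Sum>(j, x)\<in>?S. on_mor F (svect_comp (inj_mor n a j x) (proj_mor n a j x)) ! i $$ (p, q))"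
    by (simp add: sum.Sigma)
  also have "\<dots> = on_mor F (svect_id n a) ! i $$ (p, q)"
    using on_mor_sum[OF a a _ _ i pq, of ?S "\<lambda>(j, x). svect_comp (inj_mor n a j x) (proj_mor n a j x)"]
      svect_comp_hom[OF proj_mor_hom inj_mor_hom]
    by (auto simp: case_prod_unfold simp flip: sum_inj_comp_proj[OF a])
  also have "\<dots> = 1\<^sub>m ?d $$ (p, q)"
    by (simp add: on_mor_id_nth[OF a i])
  finally show "(gauge_mat i a * gauge_inv_mat i a) $$ (p, q) = 1\<^sub>m ?d $$ (p, q)" .
qed (simp_all add: gauge_mat_def gauge_inv_mat_def)

text \<open>Naturality at the identity supplies the other inverse law. A matrix with a two-sided
  inverse is square, and this yields the dimension of the \<open>i\<close>-th component of
  \<open>F\<close> at an arbitrary object.\<close>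

lemma gauge_mat_inverse:
  assumes i: "i < m" and a: "a \<in> carrier_vec n"
  shows on_obj_nth: "on_obj F a $ i = a \<bullet> rk i"
    and gauge_mat_carrier: "gauge_mat i a \<in> carrier_mat (a \<bullet> rk i) (a \<bullet> rk i)"
    and gauge_inv_mat_carrier: "gauge_inv_mat i a \<in> carrier_mat (a \<bullet> rk i) (a \<bullet> rk i)"
    and gauge_inv_mult_mat: "gauge_inv_mat i a * gauge_mat i a = 1\<^sub>m (a \<bullet> rk i)"
proof -
  have carrier: "gauge_mat i a \<in> carrier_mat (on_obj F a $ i) (a \<bullet> rk i)"
    "gauge_inv_mat i a \<in> carrier_mat (a \<bullet> rk i) (on_obj F a $ i)"
    unfolding gauge_mat_def gauge_inv_mat_def by (intro carrier_matI; simp)+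
  have "on_mor F (svect_id n a) ! i = 1\<^sub>m (on_obj F a $ i)"
    by (rule on_mor_id_nth[OF a i])
  then have "gauge_inv_mat i a * gauge_mat i a = ref_mor (rk i) (svect_id n a)"
    using gauge_mat_naturality[OF i a a svect_id_hom] carrier by simp
  also have "\<dots> = label_mat (ref_basis (rk i) a) (ref_basis (rk i) a) (\<lambda>k l. if k = l then 1 else 0)"
    unfolding ref_mor_eq[OF rk_carrier svect_id_hom] using rk_carrier[of i]
    by (intro label_mat_cong) (auto simp: set_ref_basis svect_id_def split: if_splits)
  also have "\<dots> = 1\<^sub>m (a \<bullet> rk i)"
    by (simp add: label_mat_one)
  finally show inv: "gauge_inv_mat i a * gauge_mat i a = 1\<^sub>m (a \<bullet> rk i)" .
  show dim: "on_obj F a $ i = a \<bullet> rk i"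
    by (rule invertible_rectangular_square[OF carrier gauge_mat_mult_inv[OF i a] inv])
  show "gauge_mat i a \<in> carrier_mat (a \<bullet> rk i) (a \<bullet> rk i)"
    and "gauge_inv_mat i a \<in> carrier_mat (a \<bullet> rk i) (a \<bullet> rk i)"
    using carrier by (simp_all add: dim)
qed

lemma on_obj_eq: "a \<in> carrier_vec n \<Longrightarrow> on_obj F a = rank_matrix n m F *\<^sub>v a"
  using on_obj_carrier[of a] rank_matrix_carrier on_obj_nth[of _ a]
  by (intro eq_vecI) (auto simp: comm_scalar_prod[of a n])

text \<open>The inclusion into \<open>C(k,n)\<close> is its identity, so the collected columns are
  those of an identity matrix. This is the normalisation in \<open>gauge_families\<close>.\<close>

lemma gauge_mat_unit_vec:
  assumes i: "i < m" and k: "k < n"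
  shows "gauge_mat i (unit_vec n k) = 1\<^sub>m (rk i $ k)"
proof -
  have "on_mor F (svect_id n (unit_vec n k)) ! i = 1\<^sub>m (rk i $ k)"
    using i k by (simp add: on_mor_id_nth index_rank_matrix)
  then show ?thesis
    using i k unfolding gauge_mat_def ref_basis_unit_vec[OF rk_carrier k] label_mat_map_col
    by (auto simp: inj_mor_unit_vec index_rank_matrix intro!: eq_matI)
qed

text \<open>Existence: naturality is solved for the image of the morphism by multiplying with
  \<open>gauge_mat\<close> on the left and \<open>gauge_inv_mat\<close> on the right. The
  restrictions make the families extensional, as \<open>is_gauge\<close> demands.\<close>

lemma is_gauge_gauge_mat:
  "is_gauge n m F (\<lambda>i\<in>{..<m}. \<lambda>a\<in>carrier_vec n. gauge_mat i a)"
proof -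
  have dim: "dim_vec (rk i) = n" for i
    using rk_carrier[of i] by simp
  have "invertible_mat (gauge_mat i a)" if "i < m" "a \<in> carrier_vec n" for i a
    using gauge_mat_carrier[OF that] gauge_inv_mat_carrier[OF that] gauge_inv_mult_mat[OF that]
      gauge_mat_mult_inv[OF that] on_obj_nth[OF that]
    by (auto simp: invertible_mat_def inverts_mat_def)
  then have "(\<lambda>a\<in>carrier_vec n. gauge_mat i a) \<in> gauge_families (rk i)" if "i < m" for i
    using that gauge_mat_carrier[OF that] gauge_mat_unit_vec[OF that]
    by (auto simp: gauge_families_def dim)
  moreover have "on_mor F fs ! i = gauge_mat i a' * ref_mor (rk i) fs * mat_inv (gauge_mat i a)"
    if i: "i < m" and a: "a \<in> carrier_vec n" and a': "a' \<in> carrier_vec n" and fs: "fs \<in> svect_hom n a a'"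
    for i a a' fs
  proof -
    let ?s = "gauge_mat i a" and ?s' = "gauge_mat i a'" and ?t = "gauge_inv_mat i a" and ?t' = "gauge_inv_mat i a'"
    let ?f = "on_mor F fs ! i"
    note s = gauge_mat_carrier[OF i a] gauge_inv_mat_carrier[OF i a]
    note s' = gauge_mat_carrier[OF i a'] gauge_inv_mat_carrier[OF i a']
    have st: "?s * ?t = 1\<^sub>m (a \<bullet> rk i)" and st': "?s' * ?t' = 1\<^sub>m (a' \<bullet> rk i)"
      using gauge_mat_mult_inv[OF i a] gauge_mat_mult_inv[OF i a'] on_obj_nth[OF i] a a' by auto
    have inv: "mat_inv ?s = ?t"
      by (rule mat_inv_eqI[OF s st gauge_inv_mult_mat[OF i a]])
    have f: "?f \<in> carrier_mat (a' \<bullet> rk i) (a \<bullet> rk i)"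
      using on_mor_nth_carrier[OF a a' fs i] on_obj_nth[OF i] a a' by simp
    have fs: "?f * ?s \<in> carrier_mat (a' \<bullet> rk i) (a \<bullet> rk i)"
      using f s by simp
    have "?s' * (?t' * (?f * ?s)) * ?t = ?s' * ?t' * (?f * ?s) * ?t"
      by (simp add: assoc_mult_mat[OF s'(1) s'(2) fs])
    also have "\<dots> = ?f * (?s * ?t)"
      unfolding st' left_mult_one_mat[OF fs] by (rule assoc_mult_mat[OF f s(1) s(2)])
    also have "\<dots> = ?f"
      unfolding st using f by simp
    finally show ?thesis
      unfolding inv gauge_mat_naturality[OF i a a' that(4)] by simp
  qed
  ultimately show ?thesis
    by (auto simp: is_gauge_def)
qed

section \<open>Consequences of the gauge equation and uniqueness\<close>

lemma is_gauge_families: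
  assumes s: "is_gauge n m F s" and i: "i < m" and a: "a \<in> carrier_vec n"
  shows "s i a \<in> carrier_mat (a \<bullet> rk i) (a \<bullet> rk i)" and "invertible_mat (s i a)"
    and "k < n \<Longrightarrow> s i (unit_vec n k) = 1\<^sub>m (rk i $ k)"
proof -
  have "s i \<in> gauge_families (rk i)"
    using s i by (auto simp: is_gauge_def)
  then show "s i a \<in> carrier_mat (a \<bullet> rk i) (a \<bullet> rk i)" "invertible_mat (s i a)"
    "k < n \<Longrightarrow> s i (unit_vec n k) = 1\<^sub>m (rk i $ k)"
    using a rk_carrier[of i] by (auto simp: gauge_families_def)
qed

lemma is_gauge_mor:
  assumes s: "is_gauge n m F s" and i: "i < m" and a: "a \<in> carrier_vec n" and a': "a' \<in> carrier_vec n"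
    and fs: "fs \<in> svect_hom n a a'"
  shows "on_mor F fs ! i = s i a' * ref_mor (rk i) fs * mat_inv (s i a)"
  using assms by (auto simp: is_gauge_def)

text \<open>The source of the inclusion is a unit vector, where the gauge is the identity, so the
  inverse factor disappears.\<close>

lemma is_gauge_inj_mor:
  assumes s: "is_gauge n m F s" and i: "i < m" and a: "a \<in> carrier_vec n" and j: "j < n"
  shows "on_mor F (inj_mor n a j x) ! i = s i a * ref_mor (rk i) (inj_mor n a j x)"
proof -
  have unit: "unit_vec n j \<bullet> rk i = rk i $ j"
    using rk_carrier[of i] j by simp
  have "mat_inv (1\<^sub>m (rk i $ j)) = 1\<^sub>m (rk i $ j)"
    by (rule mat_inv_eqI) auto
  then have "on_mor F (inj_mor n a j x) ! i = s i a * ref_mor (rk i) (inj_mor n a j x) * 1\<^sub>m (rk i $ j)"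
    using is_gauge_mor[OF s i _ a inj_mor_hom, of j x] is_gauge_families(3)[OF s i a j] by simp
  then show ?thesis
    using ref_mor_carrier[OF rk_carrier[of i] inj_mor_hom, of a j x] is_gauge_families(1)[OF s i a]
    by (simp add: unit)
qed

text \<open>Both gauges have the same product with every inclusion, which determines them at each
  object; extensionality settles the values elsewhere.\<close>

lemma is_gauge_unique:
  assumes s: "is_gauge n m F s" and s': "is_gauge n m F s'"
  shows "s = s'"
proof -
  have "s i a = s' i a" if i: "i < m" and a: "a \<in> carrier_vec n" for i a
    using is_gauge_inj_mor[OF s i a] is_gauge_inj_mor[OF s' i a]
    by (intro ref_mor_inj_cancel[OF rk_carrier is_gauge_families(1)[OF s i a] is_gauge_families(1)[OF s' i a]]) simp
  moreover have S: "s i \<in> extensional (carrier_vec n)" "s' i \<in> extensional (carrier_vec n)" if "i < m" for i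
    using s s' that rk_carrier[of i] by (auto simp: is_gauge_def gauge_families_def PiE_def Pi_def)
  ultimately have "s i = s' i" if "i < m" for i
    using that by (intro extensionalityI[OF S]) auto
  moreover have "s \<in> extensional {..<m}" "s' \<in> extensional {..<m}"
    using s s' by (auto simp: is_gauge_def PiE_def)
  ultimately show ?thesis
    by (auto intro: extensionalityI[of s "{..<m}" s'])
qed

lemma is_gauge_gauge: "is_gauge n m F (gauge n m F)"
  unfolding gauge_def by (rule theI[where P = "is_gauge n m F", OF is_gauge_gauge_mat]) (rule is_gauge_unique[OF _ is_gauge_gauge_mat])

end

section \<open>Composition\<close>

lemma linear_functor_comp:
  assumes "is_linear_functor n m F" and "is_linear_functor m p G"
  shows "is_linear_functor n p (G \<circ>\<^sub>F F)"
proof -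
  interpret F: linear_svect_functor n m F by unfold_locales fact
  interpret G: linear_svect_functor m p G by unfold_locales fact
  show ?thesis
    unfolding is_linear_functor_def is_functor_def functor_comp_def
    by (auto simp: F.on_obj_carrier G.on_obj_carrier F.on_mor_id G.on_mor_id
        intro!: G.on_mor_hom F.on_mor_hom)
      (metis F.on_mor_comp G.on_mor_comp F.on_obj_carrier F.on_mor_hom
        F.on_mor_add G.on_mor_add F.on_mor_smult G.on_mor_smult)+
qed

text \<open>Column \<open>j\<close> of the rank matrix of \<open>F\<close> is the object
  \<open>F(C(j,n))\<close>, and \<open>on_obj_nth\<close> evaluates \<open>G\<close> at this object,
  which need not be a unit vector.\<close>

lemma rank_matrix_comp:
  assumes "is_linear_functor n m F" and "is_linear_functor m p G"
  shows "rank_matrix n p (G \<circ>\<^sub>F F) = rank_matrix m p G * rank_matrix n m F"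
proof -
  interpret F: linear_svect_functor n m F by unfold_locales fact
  interpret G: linear_svect_functor m p G by unfold_locales fact
  have "on_obj G (on_obj F (unit_vec n j)) $ k = row (rank_matrix m p G) k \<bullet> col (rank_matrix n m F) j"
    if "k < p" "j < n" for k j
  proof -
    have "on_obj F (unit_vec n j) = col (rank_matrix n m F) j"
      using F.on_obj_carrier[of "unit_vec n j"] that by (intro eq_vecI) (auto simp: index_rank_matrix)
    moreover have "col (rank_matrix n m F) j \<in> carrier_vec m"
      by (intro carrier_vecI) simp
    ultimately show ?thesis
      using that G.on_obj_nth[of k "col (rank_matrix n m F) j"] G.rk_carrier[of k]
      by (simp add: comm_scalar_prod[of _ m])
  qed
  then show ?thesis
    by (auto simp: index_rank_matrix functor_comp_def intro!: eq_matI)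
qed

section \<open>The permutation matrix in labelled bases\<close>

definition perm_basis :: "nat vec \<Rightarrow> nat mat \<Rightarrow> nat vec \<Rightarrow> (nat \<times> nat \<times> nat \<times> nat \<times> nat) list" where
  "perm_basis r' R a =
     list_Sigma [0..<dim_row R] (\<lambda>i. list_Sigma [0..<r' $ i] (\<lambda>_. ref_basis (row R i) a))"

lemma perm_target_eq: "perm_target r' R a = perm_basis r' R a"
  by (auto simp: perm_target_def perm_basis_def ref_basis_def list_Sigma_def map_concat comp_def
      intro!: arg_cong[where f = concat] map_cong)

lemma perm_source_eq:
  "perm_source r' R a = ref_basis (vec (dim_col R) (perm_mult r' R)) a"
  by (auto simp: perm_source_def ref_basis_def list_Sigma_def map_concat comp_def
      intro!: arg_cong[where f = concat] map_cong)

lemma perm_triples_eq: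
  "perm_triples r' R j
    = list_Sigma [0..<dim_row R] (\<lambda>i. list_Sigma [0..<r' $ i] (\<lambda>_. [0..<R $$ (i, j)]))"
  by (auto simp: perm_triples_def list_Sigma_def map_concat comp_def
      intro!: arg_cong[where f = concat] map_cong)

lemma sum_list_upt: "(\<Sum>i\<leftarrow>[0..<n]. f i) = (\<Sum>i<n. f i)" for f :: "nat \<Rightarrow> nat"
  by (simp add: interv_sum_list_conv_sum_set_nat lessThan_atLeast0)

lemma length_perm_triples: "length (perm_triples r' R j) = perm_mult r' R j"
  by (simp add: perm_triples_eq perm_mult_def length_list_Sigma sum_list_upt sum_list_triv)

text \<open>Target labels are counted by copies first, source labels by components first; exchanging
  the summations shows that there are equally many.\<close>

lemma length_perm_basis:
  "length (perm_basis r' R a) = (\<Sum>j<dim_col R. perm_mult r' R j * a $ j)"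
proof -
  have "length (perm_basis r' R a) = (\<Sum>i<dim_row R. r' $ i * (\<Sum>j<dim_col R. a $ j * R $$ (i, j)))"
    by (simp add: perm_basis_def length_list_Sigma sum_list_upt sum_list_triv scalar_prod_def lessThan_atLeast0)
  also have "\<dots> = (\<Sum>i<dim_row R. \<Sum>j<dim_col R. r' $ i * R $$ (i, j) * a $ j)"
    by (simp add: sum_distrib_left ac_simps)
  also have "\<dots> = (\<Sum>j<dim_col R. perm_mult r' R j * a $ j)"
    by (subst sum.swap) (simp add: perm_mult_def sum_distrib_right)
  finally show ?thesis .
qed

lemma perm_matrix_eq:
  "perm_matrix r' R a
    = label_mat (perm_basis r' R a) (ref_basis (vec (dim_col R) (perm_mult r' R)) a)
        (\<lambda>l (j, t, x). case perm_triples r' R j ! t of (i, u, v) \<Rightarrow> if l = (i, u, j, v, x) then 1 else 0)"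
proof -
  have len: "a \<bullet> vec (dim_col R) (perm_mult r' R) = (\<Sum>j<dim_col R. perm_mult r' R j * a $ j)"
    by (simp add: scalar_prod_def lessThan_atLeast0 mult.commute)
  show ?thesis
    unfolding perm_matrix_def Let_def perm_source_eq perm_target_eq
    by (rule eq_matI) (simp_all add: len length_perm_basis)
qed

text \<open>The inclusion extracts the columns of \<open>P\<close> labelled
  \<open>(j, t, x)\<close>, which are the unit vectors at \<open>(i, u, j, v, x)\<close> with
  \<open>(i, u, v)\<close> the \<open>t\<close>-th triple. In lexicographic order these triples are
  the column labels of the block diagonal on the right.\<close>

lemma perm_matrix_ref_inj:
  fixes r' :: "nat vec" and R :: "nat mat"
  assumes R: "R \<in> carrier_mat m n" and j: "j < n" and x: "x < a $ j"
  shows "(perm_matrix r' R a :: complex mat) * ref_mor (vec n (perm_mult r' R)) (inj_mor n a j x)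
    = diag_block_mat (map (\<lambda>i. 1\<^sub>m (r' $ i) \<otimes>\<^sub>K ref_mor (row R i) (inj_mor n a j x)) [0..<m])"
proof -
  let ?r = "vec n (perm_mult r' R)" and ?T = "perm_triples r' R j"
  have r: "?r \<in> carrier_vec n" by simp
  have row: "row R i \<in> carrier_vec n" for i
    using R by (intro carrier_vecI) simp
  have "(perm_matrix r' R a :: complex mat) * ref_mor ?r (inj_mor n a j x)
    = label_mat (perm_basis r' R a) [0..<length ?T]
        (\<lambda>l t. case ?T ! t of (i, u, v) \<Rightarrow> if l = (i, u, j, v, x) then 1 else 0)"
    using R j x unfolding perm_matrix_eq ref_mor_inj[OF r j x]
    by (auto simp: label_mat_mult length_perm_triples mem_ref_basis if_distrib cong: if_cong intro!: label_mat_cong)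
  \<comment> \<open>The columns are renamed from positions \<open>t\<close> to the triples
    themselves.\<close>
  also have "\<dots> = label_mat (perm_basis r' R a) ?T
        (\<lambda>l (i, u, v). if l = (i, u, j, v, x) then 1 else 0)"
    by (rule label_mat_nth[symmetric])
  also have "\<dots> = label_mat (perm_basis r' R a) ?T
        (\<lambda>(i, u, l) (i', u', v). if i = i' \<and> u = u' then if l = (j, v, x) then 1 else 0 else 0)"
    by (intro label_mat_cong) auto
  also have "\<dots> = diag_block_mat (map (\<lambda>i. 1\<^sub>m (r' $ i) \<otimes>\<^sub>K ref_mor (row R i) (inj_mor n a j x)) [0..<m])"
    using R j ref_mor_inj[OF row j x]
    by (subst diag_block_kronecker_left[where f = "\<lambda>_ l v. if l = (j, v, x) then 1 else 0"])
      (auto simp: perm_basis_def perm_triples_eq)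
  finally show ?thesis .
qed

section \<open>Products with block diagonal factors\<close>

lemma diag_block_kronecker_ref_basis:
  assumes r: "r \<in> carrier_vec n" and B: "\<And>j. j < n \<Longrightarrow> B j \<in> carrier_mat (r $ j) (r $ j)"
  shows "diag_block_mat (map (\<lambda>j. B j \<otimes>\<^sub>K 1\<^sub>m (a $ j)) [0..<n])
    = label_mat (ref_basis r a) (ref_basis r a)
        (\<lambda>(j, t, x) (j', t', x'). if j = j' \<and> x = x' then B j $$ (t, t') else (0 :: 'd :: semiring_1))"
  using r by (subst diag_block_kronecker_right[OF B]) (auto simp: ref_basis_def)

text \<open>The block diagonal keeps \<open>j\<close> and \<open>x\<close> and mixes only the copies
  \<open>t\<close>, while the inclusion keeps the copies apart; hence \<open>B j\<close> can pass to
  the other side.\<close>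

lemma diag_block_kronecker_ref_inj:
  assumes r: "r \<in> carrier_vec n" and B: "\<And>j. j < n \<Longrightarrow> B j \<in> carrier_mat (r $ j) (r $ j)"
    and j: "j < n" and x: "x < a $ j"
  shows "diag_block_mat (map (\<lambda>j. B j \<otimes>\<^sub>K 1\<^sub>m (a $ j)) [0..<n]) * ref_mor r (inj_mor n a j x)
    = ref_mor r (inj_mor n a j x) * B j"
proof -
  have "diag_block_mat (map (\<lambda>j. B j \<otimes>\<^sub>K 1\<^sub>m (a $ j)) [0..<n]) * ref_mor r (inj_mor n a j x)
    = label_mat (ref_basis r a) [0..<r $ j] (\<lambda>(k, t, y) t'. if k = j \<and> y = x then B j $$ (t, t') else 0)"
    using r j x unfolding ref_mor_inj[OF r j x]
    by (subst diag_block_kronecker_ref_basis[OF r B])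
      (auto simp: label_mat_mult mem_ref_basis if_distrib cong: if_cong intro!: label_mat_cong)
  \<comment> \<open>The entry is written as a sum concentrated at \<open>t = s\<close>, the shape
    that \<open>label_mat_mult\<close> gives to the product on the right.\<close>
  also have "\<dots> = label_mat (ref_basis r a) [0..<r $ j] (\<lambda>(k, s, y) t'. \<Sum>t\<in>set [0..<r $ j].
      if t = s then if k = j \<and> y = x then B j $$ (s, t') else 0 else 0)"
    using r by (intro label_mat_cong) (auto simp: set_ref_basis)
  also have "\<dots> = ref_mor r (inj_mor n a j x) * label_mat [0..<r $ j] [0..<r $ j] (\<lambda>s t. B j $$ (s, t))"
    unfolding ref_mor_inj[OF r j x]
    by (auto simp: label_mat_mult if_distrib intro!: label_mat_cong sum.cong)
  also have "label_mat [0..<r $ j] [0..<r $ j] (\<lambda>s t. B j $$ (s, t)) = B j"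
    by (rule label_mat_upt[OF B[OF j], symmetric])
  finally show ?thesis .
qed

text \<open>In the sum over middle labels \<open>(i', u', k)\<close> only the block and copy of the
  given row survive, which leaves the inner sum of the product of two blocks.\<close>

lemma diag_block_kronecker_mult:
  fixes A B :: "nat \<Rightarrow> 'a :: semiring_1 mat"
  assumes A: "\<And>i. i < m \<Longrightarrow> A i \<in> carrier_mat (d i) (e i)"
    and B: "\<And>i. i < m \<Longrightarrow> B i \<in> carrier_mat (e i) (f i)"
  shows "diag_block_mat (map (\<lambda>i. 1\<^sub>m (r i) \<otimes>\<^sub>K (A i * B i)) [0..<m])
    = diag_block_mat (map (\<lambda>i. 1\<^sub>m (r i) \<otimes>\<^sub>K A i) [0..<m])
      * diag_block_mat (map (\<lambda>i. 1\<^sub>m (r i) \<otimes>\<^sub>K B i) [0..<m])"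
proof -
  let ?L = "\<lambda>d. list_Sigma [0..<m] (\<lambda>i. list_Sigma [0..<r i] (\<lambda>_. [0..<d i]))"
  have AB: "A i * B i = label_mat [0..<d i] [0..<f i] (\<lambda>p q. \<Sum>k = 0..<e i. A i $$ (p, k) * B i $$ (k, q))"
    if "i < m" for i
    by (subst label_mat_upt[OF A[OF that]], subst label_mat_upt[OF B[OF that]]) (simp add: label_mat_mult)
  let ?W = "\<lambda>f. \<lambda>(i, u, a) (i', u', b). if i = i' \<and> u = u' then f i a b else 0"
  have dA: "diag_block_mat (map (\<lambda>i. 1\<^sub>m (r i) \<otimes>\<^sub>K A i) [0..<m])
      = label_mat (?L d) (?L e) (?W (\<lambda>i p q. A i $$ (p, q)))"
    by (rule diag_block_kronecker_left) (rule label_mat_upt[OF A])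
  have dB: "diag_block_mat (map (\<lambda>i. 1\<^sub>m (r i) \<otimes>\<^sub>K B i) [0..<m])
      = label_mat (?L e) (?L f) (?W (\<lambda>i p q. B i $$ (p, q)))"
    by (rule diag_block_kronecker_left) (rule label_mat_upt[OF B])
  have dAB: "diag_block_mat (map (\<lambda>i. 1\<^sub>m (r i) \<otimes>\<^sub>K (A i * B i)) [0..<m])
      = label_mat (?L d) (?L f) (?W (\<lambda>i p q. \<Sum>k = 0..<e i. A i $$ (p, k) * B i $$ (k, q)))"
    by (rule diag_block_kronecker_left) (rule AB)
  have distinct: "distinct (?L e)"
    by (intro distinct_list_Sigma) auto
  have "(\<Sum>(i', u', k)\<in>(SIGMA i:{0..<m}. {0..<r i} \<times> {0..<e i}).
      (if i = i' \<and> u = u' then A i $$ (p, k) else 0) *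
      (if i' = j \<and> u' = v then B i' $$ (k, q) else 0))
    = (if i = j \<and> u = v then \<Sum>k = 0..<e i. A i $$ (p, k) * B i $$ (k, q) else 0)"
    if "i < m" "u < r i" for i u p j v q
  proof -
    have "(\<Sum>(i', u', k)\<in>(SIGMA i:{0..<m}. {0..<r i} \<times> {0..<e i}).
      (if i = i' \<and> u = u' then A i $$ (p, k) else 0) *
      (if i' = j \<and> u' = v then B i' $$ (k, q) else 0))
      = (\<Sum>(i', u', k)\<in>(\<lambda>k. (i, u, k)) ` {0..<e i}.
      (if i = i' \<and> u = u' then A i $$ (p, k) else 0) *
      (if i' = j \<and> u' = v then B i' $$ (k, q) else 0))"
      using that by (intro sum.mono_neutral_right) auto
    also have "\<dots> = (if i = j \<and> u = v then \<Sum>k = 0..<e i. A i $$ (p, k) * B i $$ (k, q) else 0)"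
      by (subst sum.reindex) (auto simp: inj_on_def)
    finally show ?thesis .
  qed
  then show ?thesis
    unfolding dA dB dAB label_mat_mult[OF distinct]
    by (intro label_mat_cong) (auto simp: case_prod_unfold cong: if_cong)
qed


theorem theorem3p9:
  fixes n m p :: nat and F G :: svect_functor
  assumes "n \<ge> 1" and "m \<ge> 1" and "p \<ge> 1"
    and "is_linear_functor n m F" and "is_linear_functor m p G"
  shows "rank_matrix n p (G \<circ>\<^sub>F F) = rank_matrix m p G * rank_matrix n m F \<and>
    (\<forall>k<p. \<forall>a\<in>carrier_vec n.
       gauge n p (G \<circ>\<^sub>F F) k a =
         gauge m p G k (rank_matrix n m F *\<^sub>v a)
         * diag_block_mat (map (\<lambda>i. 1\<^sub>m (rank_matrix m p G $$ (k, i)) \<otimes>\<^sub>K gauge n m F i a) [0..<m])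
         * perm_matrix (row (rank_matrix m p G) k) (rank_matrix n m F) a
         * diag_block_mat
             (map (\<lambda>j. mat_inv (gauge m p G k (rank_matrix n m F *\<^sub>v unit_vec n j)) \<otimes>\<^sub>K 1\<^sub>m (a $ j)) [0..<n]))"
proof (intro conjI allI impI ballI)
  interpret F: linear_svect_functor n m F by unfold_locales fact
  interpret G: linear_svect_functor m p G by unfold_locales fact
  interpret GF: linear_svect_functor n p "G \<circ>\<^sub>F F"
    by unfold_locales (rule linear_functor_comp[OF assms(4,5)])
  show rank: "rank_matrix n p (G \<circ>\<^sub>F F) = rank_matrix m p G * rank_matrix n m F"
    by (rule rank_matrix_comp[OF assms(4,5)])
  fix k :: nat and a :: "nat vec" assume k: "k < p" and a: "a \<in> carrier_vec n"
  let ?R = "rank_matrix n m F" and ?r' = "row (rank_matrix m p G) k" and ?r = "GF.rk k"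
  let ?b = "?R *\<^sub>v a"
  let ?g = "gauge m p G k"
  let ?B = "\<lambda>j. mat_inv (?g (?R *\<^sub>v unit_vec n j))"
  let ?S = "diag_block_mat (map (\<lambda>i. 1\<^sub>m (?r' $ i) \<otimes>\<^sub>K gauge n m F i a) [0..<m])"
  let ?P = "perm_matrix ?r' ?R a :: complex mat"
  let ?D = "diag_block_mat (map (\<lambda>j. ?B j \<otimes>\<^sub>K 1\<^sub>m (a $ j)) [0..<n])"
  note F_gauge = F.is_gauge_gauge and G_gauge = G.is_gauge_gauge and GF_gauge = GF.is_gauge_gauge
  have b: "?b \<in> carrier_vec m" and be: "?R *\<^sub>v unit_vec n j \<in> carrier_vec m" for j
    by (auto intro!: carrier_vecI)
  \<comment> \<open>By the rank formula, the rank vector of the composite is the vector of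
    multiplicities underlying the permutation matrix.\<close>
  have r: "?r = vec n (perm_mult ?r' ?R)"
    using k by (intro eq_vecI) (auto simp: rank perm_mult_def scalar_prod_def lessThan_atLeast0)
  have r_carrier: "?r \<in> carrier_vec n"
    by (rule GF.rk_carrier)
  \<comment> \<open>The left side is the size of \<open>?g\<close> at \<open>F(C(j,n))\<close>, so
    \<open>?B j\<close> acts on the \<open>?r $ j\<close> copies of component
    \<open>j\<close>.\<close>
  have r_nth: "(?R *\<^sub>v unit_vec n j) \<bullet> ?r' = ?r $ j" if "j < n" for j
    using that k by (auto simp: r perm_mult_def scalar_prod_def lessThan_atLeast0 mult.commute if_distrib cong: if_cong
        intro!: sum.cong)
  have dim_b: "length (perm_basis ?r' ?R a) = ?b \<bullet> ?r'"
    using a by (simp add: perm_basis_def length_list_Sigma sum_list_upt sum_list_triv scalar_prod_def lessThan_atLeast0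
        mult.commute)
  \<comment> \<open>Counting the labels of the permutation in both ways shows that the gauge of the
    composite at \<open>a\<close> and that of \<open>G\<close> at \<open>?b\<close> have the same
    size.\<close>
  have dim_GF: "a \<bullet> ?r = ?b \<bullet> ?r'"
    unfolding dim_b[symmetric] length_perm_basis by (simp add: r scalar_prod_def lessThan_atLeast0 mult.commute)
  have g: "?g ?b \<in> carrier_mat (?b \<bullet> ?r') (?b \<bullet> ?r')"
    by (rule G.is_gauge_families(1)[OF G_gauge k b])
  have S: "?S \<in> carrier_mat (?b \<bullet> ?r') (?b \<bullet> ?r')"
  proof -
    have gF: "gauge n m F i a \<in> carrier_mat (?b $ i) (?b $ i)" if "i < m" for i
      using F.is_gauge_families(1)[OF F_gauge that a] F.on_obj_nth[OF that a] by (simp add: F.on_obj_eq[OF a])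
    have "?S = label_mat (ref_basis ?r' ?b) (ref_basis ?r' ?b)
        (\<lambda>(i, u, p) (i', u', q). if i = i' \<and> u = u' then gauge n m F i a $$ (p, q) else 0)"
      by (subst diag_block_kronecker_left[OF label_mat_upt[OF gF]]) (auto simp: ref_basis_def)
    then show ?thesis
      using label_mat_carrier[of "ref_basis ?r' ?b" "ref_basis ?r' ?b"] by simp
  qed
  have P: "?P \<in> carrier_mat (?b \<bullet> ?r') (a \<bullet> ?r)"
    unfolding perm_matrix_eq dim_b[symmetric] using label_mat_carrier[of "perm_basis ?r' ?R a" "ref_basis ?r a"]
    by (simp add: r)
  have B: "?B j \<in> carrier_mat (?r $ j) (?r $ j)" if "j < n" for j
    using mat_inv_mult(3)[OF G.is_gauge_families(1,2)[OF G_gauge k be[of j]]] unfolding r_nth[OF that] .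
  have D: "?D \<in> carrier_mat (a \<bullet> ?r) (a \<bullet> ?r)"
    using label_mat_carrier[of "ref_basis ?r a" "ref_basis ?r a"]
    by (subst diag_block_kronecker_ref_basis[OF r_carrier B]) auto
  have S_eq: "diag_block_mat (map (\<lambda>i. 1\<^sub>m (rank_matrix m p G $$ (k, i)) \<otimes>\<^sub>K gauge n m F i a) [0..<m]) = ?S"
    using k by (auto intro!: arg_cong[where f = diag_block_mat])
  have "gauge n p (G \<circ>\<^sub>F F) k a = ?g ?b * ?S * ?P * ?D"
  proof (rule ref_mor_inj_cancel[OF r_carrier GF.is_gauge_families(1)[OF GF_gauge k a]])
    show "?g ?b * ?S * ?P * ?D \<in> carrier_mat (a \<bullet> ?r) (a \<bullet> ?r)"
      using mult_carrier_mat[OF mult_carrier_mat[OF mult_carrier_mat[OF g S] P] D] by (simp only: dim_GF)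
    fix j x assume j: "j < n" and x: "x < a $ j"
    let ?\<iota> = "inj_mor n a j x"
    let ?K = "\<lambda>i. ref_mor (row ?R i) ?\<iota>"
    let ?E = "ref_mor ?r ?\<iota>"
    have E: "?E \<in> carrier_mat (a \<bullet> ?r) (?r $ j)"
      using ref_mor_carrier[OF r_carrier inj_mor_hom, of a j x] j r_carrier by simp
    have "gauge n p (G \<circ>\<^sub>F F) k a * ?E = on_mor (G \<circ>\<^sub>F F) ?\<iota> ! k"
      by (rule GF.is_gauge_inj_mor[OF GF_gauge k a j, symmetric])
    also have "\<dots> = on_mor G (on_mor F ?\<iota>) ! k"
      by (simp add: functor_comp_def)
    \<comment> \<open>The source \<open>F(C(j,n))\<close> need not be a unit vector, so the inverse
      gauge \<open>?B j\<close> remains; it is the origin of the last factor of the formula.\<close>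
    also have "\<dots> = ?g ?b * ref_mor ?r' (on_mor F ?\<iota>) * ?B j"
      using F.on_mor_hom[OF _ a inj_mor_hom, of j x] j
      by (intro G.is_gauge_mor[OF G_gauge k be b]) (simp add: F.on_obj_eq[OF a] F.on_obj_eq[of "unit_vec n j"])
    \<comment> \<open>The gauge of \<open>F\<close> is trivial at the source of the inclusion, so
      each component of \<open>F\<close> contributes a left factor only.\<close>
    also have "ref_mor ?r' (on_mor F ?\<iota>)
        = diag_block_mat (map (\<lambda>i. 1\<^sub>m (?r' $ i) \<otimes>\<^sub>K (gauge n m F i a * ?K i)) [0..<m])"
      using F.is_gauge_inj_mor[OF F_gauge _ a j]
      by (auto simp: ref_functor_def intro!: arg_cong[where f = diag_block_mat])
    also have "\<dots> = ?S * diag_block_mat (map (\<lambda>i. 1\<^sub>m (?r' $ i) \<otimes>\<^sub>K ?K i) [0..<m])"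
      using F.is_gauge_families(1)[OF F_gauge _ a] ref_mor_carrier[OF F.rk_carrier inj_mor_hom]
      by (rule diag_block_kronecker_mult)
    also have "diag_block_mat (map (\<lambda>i. 1\<^sub>m (?r' $ i) \<otimes>\<^sub>K ?K i) [0..<m]) = ?P * ?E"
      unfolding r by (rule perm_matrix_ref_inj[OF F.rank_matrix_carrier j x, symmetric])
    also have "?g ?b * (?S * (?P * ?E)) * ?B j = ?g ?b * ?S * ?P * (?E * ?B j)"
      unfolding assoc_mult_mat[OF mult_carrier_mat[OF mult_carrier_mat[OF g S] P] E B[OF j], symmetric]
        assoc_mult_mat[OF mult_carrier_mat[OF g S] P E] assoc_mult_mat[OF g S mult_carrier_mat[OF P E]] ..
    \<comment> \<open>Moving \<open>?B j\<close> across the inclusion turns it into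
      \<open>?D\<close> and leaves the inclusion rightmost, as the cancellation requires.\<close>
    also have "?E * ?B j = ?D * ?E"
      by (rule diag_block_kronecker_ref_inj[OF r_carrier B j x, symmetric])
    also have "?g ?b * ?S * ?P * (?D * ?E) = ?g ?b * ?S * ?P * ?D * ?E"
      using g S P D E by (intro assoc_mult_mat[symmetric]) auto
    finally show "gauge n p (G \<circ>\<^sub>F F) k a * ?E = ?g ?b * ?S * ?P * ?D * ?E" .
  qed
  then show "gauge n p (G \<circ>\<^sub>F F) k a =
         gauge m p G k (rank_matrix n m F *\<^sub>v a)
         * diag_block_mat (map (\<lambda>i. 1\<^sub>m (rank_matrix m p G $$ (k, i)) \<otimes>\<^sub>K gauge n m F i a) [0..<m])
         * perm_matrix (row (rank_matrix m p G) k) (rank_matrix n m F) a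
         * diag_block_mat
             (map (\<lambda>j. mat_inv (gauge m p G k (rank_matrix n m F *\<^sub>v unit_vec n j)) \<otimes>\<^sub>K 1\<^sub>m (a $ j)) [0..<n])"
    unfolding S_eq .
qed

end
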